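(* Let $n$ be a positive integer with $n\equiv 5\pmod 6$. Then, modulo $\Phi_n(q)^3$, \begin{align*} \sum_{k=0}^{(n+1)/3}\frac{(q^{-1};q^3)_k^3}{(q^3;q^3)_k^3}q^{9k} &\equiv q^{(2-n)/3}(1+q)\frac{(q;q^3)_{(n+1)/3}^2}{(q^3;q^3)_{(n+1)/3}^2}\\ &\quad\times\bigg\{\theta_n(q)+[n]^2\bigg(\sum_{i=1}^{(n+1)/3}\frac{3q^{3i-2}}{[3i-2]^2}-\frac{1+5q+3q^2}{1+q}\bigg)\bigg\}, \end{align*} where $$\theta_n(q)=\frac{(1-q-3q^2)(1-2q^n)+(4-4q-6q^2+3q^3)q^{2n}}{(1+q)(q-q^n)^2}.$$
   Context: For a variable $x$ and base $q$, the $q$-shifted factorial is $(x;q)_0=1$ and $(x;q)_k=(1-x)(1-xq)\cdots(1-xq^{k-1})$ for positive integers $k$. The $q$-integer is $[m]=(1-q^m)/(1-q)$. $\Phi_n(q)$ denotes the $n$-th cyclotomic polynomial in $q$. A congruence $A(q)\equiv B(q)\pmod{\Phi_n(q)^3}$ between rational functions in $q$ whose denominators are coprime to $\Phi_n(q)$ means that the numerator of $A(q)-B(q)$ (in lowest terms) is divisible by $\Phi_n(q)^3$ in $\mathbb{Z}[q]$. *)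

theory Defs
  imports
    "HOL-Computational_Algebra.Computational_Algebra"
    "HOL-Number_Theory.Cong"
begin

definition primitive_roots_unity :: "nat \<Rightarrow> complex set" where
  "primitive_roots_unity n = {z. z ^ n = 1 \<and> (\<forall>m. 0 < m \<and> m < n \<longrightarrow> z ^ m \<noteq> 1)}"

text \<open>
  The integer polynomial that equals the product of $X - \zeta$ over the primitive $n$-th roots
  of unity; the lemma \<open>cyclotomic_poly\<close> below shows that it exists.
\<close>

definition cyclotomic :: "nat \<Rightarrow> int poly" where
  "cyclotomic n = (THE p. map_poly of_int p = (\<Prod>z\<in>primitive_roots_unity n. [:- z, 1:]))"

lemma of_int_poly_mult:
  "map_poly of_int (p * q) = (map_poly of_int p * map_poly of_int q :: 'a :: {comm_ring_1,ring_char_0} poly)"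
  by (rule poly_eqI) (simp add: coeff_map_poly coeff_mult)

lemma of_int_poly_add:
  "map_poly of_int (p + q) = (map_poly of_int p + map_poly of_int q :: 'a :: {comm_ring_1,ring_char_0} poly)"
  by (rule poly_eqI) (simp add: coeff_map_poly)

lemma of_int_poly_prod:
  "map_poly of_int (prod f A) = (\<Prod>x\<in>A. map_poly of_int (f x) :: 'a :: {comm_ring_1,ring_char_0} poly)"
  by (induction A rule: infinite_finite_induct) (auto simp: of_int_poly_mult map_poly_1)

lemma of_int_poly_eq_iff:
  "map_poly of_int p = (map_poly of_int q :: 'a :: {comm_ring_1,ring_char_0} poly) \<longleftrightarrow> p = q"
  by (auto simp: poly_eq_iff coeff_map_poly)

lemma primitive_roots_unity_order:
  assumes "z ^ n = (1 :: complex)" "n > 0"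
  shows "\<exists>d. d dvd n \<and> z \<in> primitive_roots_unity d"
proof -
  define d where "d = (LEAST m. 0 < m \<and> z ^ m = 1)"
  have d: "0 < d \<and> z ^ d = 1"
    unfolding d_def by (rule LeastI[of _ n]) (use assms in auto)
  have least: "d \<le> m" if "0 < m" "z ^ m = 1" for m
    unfolding d_def by (rule Least_le) (use that in auto)
  have "z ^ n = z ^ (d * (n div d) + n mod d)"
    by simp
  also have "\<dots> = z ^ (n mod d)"
    using d by (simp only: power_add power_mult) simp
  finally have "z ^ (n mod d) = 1"
    using assms by simp
  moreover have "n mod d < d"
    using d by simp
  ultimately have "n mod d = 0"
    using least[of "n mod d"] by (cases "n mod d = 0") auto
  hence "d dvd n"
    by (simp add: mod_eq_0_iff_dvd)
  moreover have "z ^ m \<noteq> 1" if "0 < m" "m < d" for m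
    using least[of m] that by linarith
  ultimately show ?thesis
    using d unfolding primitive_roots_unity_def by blast
qed

lemma roots_unity_decompose:
  assumes "n > 0"
  shows "{z :: complex. z ^ n = 1} = (\<Union>d\<in>{d. d dvd n}. primitive_roots_unity d)"
proof (intro equalityI subsetI)
  fix z :: complex assume "z \<in> {z. z ^ n = 1}"
  thus "z \<in> (\<Union>d\<in>{d. d dvd n}. primitive_roots_unity d)"
    using primitive_roots_unity_order[of z n] assms by auto
next
  fix z :: complex assume "z \<in> (\<Union>d\<in>{d. d dvd n}. primitive_roots_unity d)"
  then obtain d where "d dvd n" "z ^ d = 1"
    by (auto simp: primitive_roots_unity_def)
  thus "z \<in> {z. z ^ n = 1}"
    by (auto simp: power_mult elim!: dvdE)
qed

lemma finite_primitive_roots_unity: "n > 0 \<Longrightarrow> finite (primitive_roots_unity n)"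
  by (rule finite_subset[OF _ finite_roots_unity[of n]]) (auto simp: primitive_roots_unity_def)

lemma primitive_roots_unity_disjoint:
  assumes "d > 0" "e > 0" "d \<noteq> e"
  shows "primitive_roots_unity d \<inter> primitive_roots_unity e = {}"
  using assms by (cases d e rule: linorder_cases) (auto simp: primitive_roots_unity_def)

lemma prod_roots_unity:
  assumes "n > 0"
  shows "(\<Prod>z | z ^ n = 1. [:- z, 1:]) = (monom 1 n - 1 :: complex poly)"
proof -
  let ?p = "monom 1 n - 1 :: complex poly"
  have deg: "degree ?p = n"
    using assms by (subst diff_conv_add_uminus, subst degree_add_eq_left) (auto simp: degree_monom_eq)
  have lc: "lead_coeff ?p = 1"
    using assms by (simp add: deg)
  have "rsquarefree ?p"
    unfolding rsquarefree_roots
    using assms by (auto simp: pderiv_diff pderiv_monom poly_monom power_0_left)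
  from complex_poly_decompose_rsquarefree[OF this] show ?thesis
    unfolding lc by (simp add: poly_monom)
qed

lemma prod_cyclotomic_complex:
  assumes "n > 0"
  shows "(\<Prod>d | d dvd n. \<Prod>z\<in>primitive_roots_unity d. [:- z, 1:]) = monom 1 n - 1"
proof -
  have "(\<Prod>z\<in>(\<Union>d\<in>{d. d dvd n}. primitive_roots_unity d). [:- z, 1:]) =
        (\<Prod>d | d dvd n. \<Prod>z\<in>primitive_roots_unity d. [:- z, 1:])"
  proof (rule prod.UNION_disjoint)
    show "finite {d. d dvd n}"
      using assms by simp
    show "\<forall>d\<in>{d. d dvd n}. finite (primitive_roots_unity d)"
      using assms by (auto intro!: finite_primitive_roots_unity dest: dvd_pos_nat)
    show "\<forall>d\<in>{d. d dvd n}. \<forall>e\<in>{d. d dvd n}. d \<noteq> e \<longrightarrow>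
            primitive_roots_unity d \<inter> primitive_roots_unity e = {}"
      using assms by (intro ballI impI primitive_roots_unity_disjoint) (auto dest: dvd_pos_nat)
  qed
  thus ?thesis
    using roots_unity_decompose[OF assms] prod_roots_unity[OF assms] by simp
qed

lemma cyclotomic_exists:
  "\<exists>p :: int poly. map_poly of_int p = (\<Prod>z\<in>primitive_roots_unity n. [:- z, 1:])"
proof (induction n rule: less_induct)
  case (less n)
  let ?c = "\<lambda>n. \<Prod>z\<in>primitive_roots_unity n. [:- z, 1:]"
  show ?case
  proof (cases "n = 0")
    case True
    have "primitive_roots_unity 0 = UNIV"
      by (auto simp: primitive_roots_unity_def)
    moreover have "infinite (UNIV :: complex set)"
      by (rule infinite_UNIV_char_0)
    ultimately show ?thesis using True
      by (intro exI[of _ 1]) (simp add: map_poly_1)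
  next
    case False
    hence n: "n > 0" by simp
    from less obtain p where p: "\<And>d. d < n \<Longrightarrow> map_poly of_int (p d :: int poly) = ?c d"
      by metis
    define D where "D = {d. d dvd n \<and> d \<noteq> n}"
    define Q where "Q = (\<Prod>d\<in>D. p d)"
    have lt: "d < n" if "d \<in> D" for d
      using that n by (auto simp: D_def dest: dvd_imp_le)
    have finD: "finite D"
      by (rule finite_subset[of _ "{..<n}"]) (auto dest: lt)
    have Q: "map_poly of_int Q = (\<Prod>d\<in>D. ?c d)"
      unfolding Q_def of_int_poly_prod by (intro prod.cong refl p lt)
    have lcQ: "lead_coeff (map_poly of_int Q :: complex poly) = 1"
      unfolding Q by (simp add: lead_coeff_prod)
    have degQ: "degree (map_poly of_int Q :: complex poly) = degree Q"
      by (rule degree_map_poly) auto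
    have lcQ': "lead_coeff Q = 1"
      using lcQ by (simp add: degQ coeff_map_poly)
    have "{d. d dvd n} = insert n D"
      by (auto simp: D_def)
    hence eq: "map_poly of_int Q * ?c n = monom 1 n - 1"
      using prod_cyclotomic_complex[OF n] finD by (simp add: Q D_def mult.commute)
    let ?f = "monom 1 n - 1 :: int poly"
    obtain s r where sr: "pseudo_divmod ?f Q = (s, r)"
      by fastforce
    have Q0: "Q \<noteq> 0" using lcQ' by auto
    have f: "?f = Q * s + r" and r: "r = 0 \<or> degree r < degree Q"
      using pseudo_divmod[OF Q0 sr] lcQ' by auto
    have "map_poly of_int ?f = (monom 1 n - 1 :: complex poly)"
      by (rule poly_eqI) (auto simp: coeff_map_poly)
    hence "map_poly of_int Q * ?c n = map_poly of_int Q * map_poly of_int s + map_poly of_int r"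
      unfolding f of_int_poly_add of_int_poly_mult using eq by simp
    hence r': "map_poly of_int Q * (?c n - map_poly of_int s) = map_poly of_int r"
      by (simp add: algebra_simps)
    have "?c n - map_poly of_int s = 0"
    proof (rule ccontr)
      assume nz: "?c n - map_poly of_int s \<noteq> 0"
      have Qnz: "(map_poly of_int Q :: complex poly) \<noteq> 0"
        using lcQ by auto
      have "degree (map_poly of_int r :: complex poly) \<ge> degree Q"
        unfolding r'[symmetric] using nz Qnz by (simp add: degree_mult_eq degQ)
      moreover have "degree (map_poly of_int r :: complex poly) = degree r"
        by (rule degree_map_poly) auto
      ultimately have "r = 0" using r by auto
      thus False using r' nz Qnz by auto
    qed
    thus ?thesis by (intro exI[of _ s]) simp
  qed
qed

lemma cyclotomic_poly:
  "map_poly of_int (cyclotomic n) = (\<Prod>z\<in>primitive_roots_unity n. [:- z, 1:])"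
proof -
  have "\<exists>!p :: int poly. map_poly of_int p = (\<Prod>z\<in>primitive_roots_unity n. [:- z, 1:])"
  proof (rule ex_ex1I[OF cyclotomic_exists])
    fix p p' :: "int poly"
    assume "map_poly of_int p = (\<Prod>z\<in>primitive_roots_unity n. [:- z, 1:])"
      and "map_poly of_int p' = (\<Prod>z\<in>primitive_roots_unity n. [:- z, 1:])"
    hence "map_poly of_int p = (map_poly of_int p' :: complex poly)" by simp
    thus "p = p'" by (simp only: of_int_poly_eq_iff)
  qed
  thus ?thesis
    unfolding cyclotomic_def by (rule theI')
qed


text \<open>
  \<open>quot_of_fract\<close> yields numerator and denominator in lowest terms. The congruence is only
  meaningful when the denominators are coprime to the modulus, so this is part of the relation.
\<close>

definition ratfun_cong :: "int poly fract \<Rightarrow> int poly fract \<Rightarrow> int poly \<Rightarrow> bool" where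
  "ratfun_cong A B M \<longleftrightarrow>
     coprime (snd (quot_of_fract A)) M \<and> coprime (snd (quot_of_fract B)) M \<and>
     M dvd fst (quot_of_fract (A - B))"

definition ratfun_var :: "int poly fract" where
  "ratfun_var = to_fract [:0, 1:]"

definition q_pochhammer :: "'a :: field \<Rightarrow> 'a \<Rightarrow> nat \<Rightarrow> 'a" where
  "q_pochhammer x q k = (\<Prod>j<k. 1 - x * q ^ j)"

definition q_int :: "'a :: field \<Rightarrow> nat \<Rightarrow> 'a" where
  "q_int q m = (1 - q ^ m) / (1 - q)"

definition theta :: "nat \<Rightarrow> 'a :: field \<Rightarrow> 'a" where
  "theta n q =
     ((1 - q - 3 * q ^ 2) * (1 - 2 * q ^ n)
        + (4 - 4 * q - 6 * q ^ 2 + 3 * q ^ 3) * q ^ (2 * n))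
     / ((1 + q) * (q - q ^ n) ^ 2)"

end

theory Submission
  imports Defs
begin

text \<open>
  Write \<open>n = 3m + 5\<close>, \<open>N = m + 2\<close>, \<open>p = q\<^sup>3\<close>. It suffices to show, for every primitive \<open>n\<close>-th root of
  unity \<open>\<zeta>\<close>, that the difference of both sides is \<open>o((q - \<zeta>)\<^sup>2)\<close> as \<open>q\<close> tends to \<open>\<zeta>\<close>: a rational function
  regular at \<open>\<zeta>\<close> with this property has a numerator divisible by \<open>(q - \<zeta>)\<^sup>3\<close>.

  Replace the square of \<open>(q\<^sup>-\<^sup>1; p)\<^sub>k\<close> in the left-hand side by the product of the factors
  \<open>1 - s x + x\<^sup>2 = (1 - a x)(1 - x/a)\<close>, where \<open>s = a + 1/a\<close>, and call the sum \<open>F(s, q)\<close>; the left-hand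
  side is \<open>F(2, q)\<close>. Put \<open>\<sigma> = q\<^sup>n + q\<^sup>-\<^sup>n\<close>, so that \<open>\<sigma> - 2 = (1 - q\<^sup>n)\<^sup>2 / q\<^sup>n\<close>. Then
  \<open>F(2, q) = F(\<sigma>, q) - (\<sigma> - 2) (\<partial>F/\<partial>s (2, \<zeta>) + o(1))\<close>.
  Both \<open>F(\<sigma>, q)\<close> and \<open>F(s, \<zeta>)\<close> are instances of one terminating sum, of
  \<open>(p\<^sup>-\<^sup>N, b, c; p)\<^sub>k / (p; p)\<^sub>k\<^sup>3 p\<^sup>3\<^sup>k\<close> with \<open>b c = p\<^sup>N\<^sup>-\<^sup>1\<close>, which is a rational multiple of a
  q-Saalschuetz sum.
\<close>

section \<open>A terminating basic hypergeometric sum\<close>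

lemma q_pochhammer_0 [simp]: "q_pochhammer x q 0 = 1"
  by (simp add: q_pochhammer_def)

lemma q_pochhammer_Suc: "q_pochhammer x q (Suc k) = q_pochhammer x q k * (1 - x * q ^ k)"
  by (simp add: q_pochhammer_def)

lemma q_pochhammer_Suc_shift: "q_pochhammer x q (Suc k) = (1 - x) * q_pochhammer (x * q) q k"
  unfolding q_pochhammer_def by (subst prod.lessThan_Suc_shift) (simp add: mult.assoc)

lemma q_pochhammer_nonzero_mono:
  "q_pochhammer x q n \<noteq> 0 \<Longrightarrow> k \<le> n \<Longrightarrow> q_pochhammer x q k \<noteq> 0"
  by (auto simp: q_pochhammer_def)

text \<open>Summand, without the power of the argument, of the basic series 3phi2 in base
  \<open>p\<close> with upper parameters \<open>a\<close>, \<open>b\<close>, \<open>c\<close> and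
  both lower parameters equal to \<open>p\<close>.\<close>

definition hyper_term :: "'a::field \<Rightarrow> 'a \<Rightarrow> 'a \<Rightarrow> 'a \<Rightarrow> nat \<Rightarrow> 'a" where
  "hyper_term p a b c k =
     q_pochhammer a p k * q_pochhammer b p k * q_pochhammer c p k / q_pochhammer p p k ^ 3"

lemma hyper_term_Suc:
  assumes "q_pochhammer p p (Suc k) \<noteq> 0"
  shows "hyper_term p a b c (Suc k) * (1 - p ^ Suc k) ^ 3 =
         hyper_term p a b c k * ((1 - a * p ^ k) * (1 - b * p ^ k) * (1 - c * p ^ k))"
  using assms by (simp add: hyper_term_def q_pochhammer_Suc power_mult_distrib)

lemma hyper_term_shift_first:
  "(1 - a) * hyper_term p (a * p) b c k = (1 - a * p ^ k) * hyper_term p a b c k"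
  using q_pochhammer_Suc[of a p k] q_pochhammer_Suc_shift[of a p k]
  by (simp add: hyper_term_def mult_ac)

lemma hyper_term_shift_third:
  "(1 - c) * hyper_term p a b (c * p) k = (1 - c * p ^ k) * hyper_term p a b c k"
  using q_pochhammer_Suc[of c p k] q_pochhammer_Suc_shift[of c p k]
  by (simp add: hyper_term_def mult_ac)

text \<open>With G(k) = \<open>hyper_term p a b c k * (1 - p ^ k) ^ 3 * g k\<close>, the ratio of
  consecutive terms turns each summand with k < N into G(k + 1) - G(k). G(0) vanishes since
  \<open>p ^ 0 = 1\<close>, and the part left over at k = N vanishes by
  \<open>a * p ^ N = 1\<close>. Each choice of \<open>g\<close> thus yields a linear relation
  between sums.\<close>

lemma hyper_term_telescope:
  fixes p :: "'a::field"
  assumes "q_pochhammer p p N \<noteq> 0" "a * p ^ N = 1"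
  shows "(\<Sum>k\<le>N. hyper_term p a b c k *
           ((1 - a * p ^ k) * (1 - b * p ^ k) * (1 - c * p ^ k) * g (Suc k)
             - (1 - p ^ k) ^ 3 * g k)) = 0"
proof -
  have "(\<Sum>k\<le>j. hyper_term p a b c k *
           ((1 - a * p ^ k) * (1 - b * p ^ k) * (1 - c * p ^ k) * g (Suc k)
             - (1 - p ^ k) ^ 3 * g k)) =
        hyper_term p a b c j * ((1 - a * p ^ j) * (1 - b * p ^ j) * (1 - c * p ^ j)) * g (Suc j)"
    if "j \<le> N" for j
    using that
  proof (induction j)
    case (Suc j)
    have "q_pochhammer p p (Suc j) \<noteq> 0"
      using assms(1) Suc.prems by (rule q_pochhammer_nonzero_mono)
    note step = hyper_term_Suc[OF this, of a b c]
    have "j \<le> N" using Suc.prems by simp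
    note IH = Suc.IH[OF this]
    show ?case
      unfolding sum.atMost_Suc IH step[symmetric] by (simp add: algebra_simps)
  qed simp
  from this[of N] show ?thesis using assms(2) by simp
qed

text \<open>The series is balanced: the product of its lower parameters is \<open>p\<close> times
  that of the upper ones. A first-order recurrence in \<open>M\<close> then determines it.\<close>

lemma q_saalschutz:
  fixes p b :: "'a::field"
  assumes "p \<noteq> 0" "b \<noteq> 0" "q_pochhammer p p M \<noteq> 0" "q_pochhammer (p / b) p M \<noteq> 0"
  shows "(\<Sum>k\<le>M. hyper_term p (inverse (p ^ M)) b (p ^ Suc M / b) k * p ^ k) =
         b ^ M * q_pochhammer (p / b) p M ^ 2 / q_pochhammer p p M ^ 2"
  using assms(3,4)
proof (induction M)
  case 0
  show ?case by (simp add: hyper_term_def)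
next
  case (Suc M)
  \<comment> \<open>Now A b c = 1, and the summands for \<open>M\<close> and \<open>Suc M\<close>
    arise from the single term \<open>hyper_term p A b c k\<close> by the shifts
    \<open>A * p\<close> and \<open>c * p\<close>. Both are therefore simple multiples of that
    term.\<close>
  define A c where "A = inverse (p ^ Suc M)" and "c = p ^ Suc M / b"
  have A0: "A \<noteq> 0" "c \<noteq> 0" and Abc: "A * b * c = 1"
    using assms(1,2) by (auto simp: A_def c_def simp del: power_Suc)
  have AM: "A * p ^ Suc M = 1" using assms(1) by (simp add: A_def del: power_Suc)
  have A1: "1 - A \<noteq> 0" and c1: "1 - c \<noteq> 0"
    using Suc.prems assms(1,2) by (auto simp: q_pochhammer_Suc A_def c_def field_simps)
  let ?r = "hyper_term p A b c"
  define S where "S = (\<Sum>k\<le>M. hyper_term p (A * p) b c k * p ^ k)"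
  define S' where "S' = (\<Sum>k\<le>Suc M. hyper_term p A b (c * p) k * p ^ k)"
  \<comment> \<open>The term of index \<open>Suc M\<close> vanishes, so the sum for \<open>M\<close>
    may run over the same range as the sum for \<open>Suc M\<close>.\<close>
  have "q_pochhammer (A * p) p (Suc M) = 0"
    using AM by (simp add: q_pochhammer_Suc mult.assoc)
  hence S: "S = (\<Sum>k\<le>Suc M. hyper_term p (A * p) b c k * p ^ k)"
    by (simp add: S_def hyper_term_def)
  \<comment> \<open>WZ certificate for the recurrence of the sum in \<open>M\<close>\<close>
  have cert: "c * (1 - A) ^ 3 * ((1 - c * y) * (r * y)) - A * (1 - c) ^ 3 * ((1 - A * y) * (r * y)) =
      - (c - A) * A * c * (r * ((1 - A * y) * (1 - b * y) * (1 - c * y) * 1 - (1 - y) ^ 3 * 1))"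
    for y r
  proof -
    \<comment> \<open>A b c = 1 removes \<open>b\<close>, which leaves a polynomial identity in
      \<open>A\<close>, \<open>c\<close>, \<open>y\<close>, \<open>r\<close>.\<close>
    have "A * c * (1 - b * y) = A * c - y" using Abc by algebra
    hence "- (c - A) * A * c * (r * ((1 - A * y) * (1 - b * y) * (1 - c * y) * 1 - (1 - y) ^ 3 * 1)) =
      - (c - A) * r * ((1 - A * y) * (A * c - y) * (1 - c * y) - A * c * (1 - y) ^ 3)"
      by algebra
    thus ?thesis by algebra
  qed
  have "c * (1 - A) ^ 3 * ((1 - c) * S') - A * (1 - c) ^ 3 * ((1 - A) * S) =
     (\<Sum>k\<le>Suc M. c * (1 - A) ^ 3 * ((1 - c * p ^ k) * (?r k * p ^ k))
        - A * (1 - c) ^ 3 * ((1 - A * p ^ k) * (?r k * p ^ k)))"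
    unfolding S S'_def sum_distrib_left sum_subtractf mult.assoc[symmetric, of _ _ "p ^ _"]
      hyper_term_shift_first hyper_term_shift_third by (simp add: mult_ac)
  also have "\<dots> = - (c - A) * A * c * (\<Sum>k\<le>Suc M. hyper_term p A b c k *
           ((1 - A * p ^ k) * (1 - b * p ^ k) * (1 - c * p ^ k) * (\<lambda>_. 1) (Suc k)
             - (1 - p ^ k) ^ 3 * (\<lambda>_. 1) k))"
    unfolding sum_distrib_left cert ..
  also have "\<dots> = 0"
    by (subst hyper_term_telescope[OF Suc.prems(1) AM]) simp
  finally have "(1 - A) * (1 - c) * (c * (1 - A) ^ 2 * S' - A * (1 - c) ^ 2 * S) = 0"
    by algebra
  hence eq: "c * (1 - A) ^ 2 * S' = A * (1 - c) ^ 2 * S"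
    using A1 c1 by simp
  have Ap: "A * p = inverse (p ^ M)" and cp: "c * p = p ^ Suc (Suc M) / b"
    using assms(1) by (auto simp: A_def c_def field_simps)
  have IH: "S = b ^ M * q_pochhammer (p / b) p M ^ 2 / q_pochhammer p p M ^ 2"
    using Suc.IH Suc.prems unfolding S_def Ap by (simp add: c_def q_pochhammer_Suc)
  have pA: "p * p ^ M = inverse A" by (simp add: A_def)
  have pc: "p * p ^ M = b * c" using assms(2) by (simp add: c_def)
  have "S' = A * (1 - c) ^ 2 * S / (c * (1 - A) ^ 2)"
    using eq A0 A1 by (simp add: field_simps)
  also have "\<dots> = b * (1 - c) ^ 2 * S / (1 - inverse A) ^ 2"
  proof -
    have "(1 - inverse A) ^ 2 = (1 - A) ^ 2 / A ^ 2"
      using A0 by (simp add: field_simps power2_eq_square)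
    hence "b * (1 - c) ^ 2 * S / (1 - inverse A) ^ 2 = b * (1 - c) ^ 2 * S * A ^ 2 / (1 - A) ^ 2"
      by simp
    also have "\<dots> = A * (1 - c) ^ 2 * S / (c * (1 - A) ^ 2)"
    proof (subst frac_eq_eq)
      show "b * (1 - c) ^ 2 * S * A ^ 2 * (c * (1 - A) ^ 2) = A * (1 - c) ^ 2 * S * (1 - A) ^ 2"
        using Abc by algebra
    qed (use A0 A1 in auto)
    finally show ?thesis ..
  qed
  also have "\<dots> = b ^ Suc M * q_pochhammer (p / b) p (Suc M) ^ 2 / q_pochhammer p p (Suc M) ^ 2"
  proof -
    have "p / b * p ^ M = c" by (simp add: c_def)
    thus ?thesis unfolding IH q_pochhammer_Suc pA by (simp add: power_mult_distrib mult_ac)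
  qed
  finally show ?case unfolding S'_def cp A_def .
qed

text \<open>
  With \<open>T j\<close> denoting the sum with weights \<open>p\<^sup>j\<^sup>k\<close>, telescoping \<open>g k = 1\<close> and \<open>g k = p\<^sup>k\<close> gives two linear
  relations between \<open>T 1\<close>, \<open>T 2\<close>, \<open>T 3\<close> (the \<open>T 4\<close> term drops out because \<open>A b c p = 1\<close>); the
  q-Saalschuetz sum with \<open>A p\<close>, \<open>c p\<close> in place of \<open>A\<close>, \<open>c\<close> is a third one.
\<close>

lemma cubic_hyper_sum:
  fixes p b c A :: "'a::field"
  defines "z \<equiv> 3 - A - c"
  assumes "p \<noteq> 0" "b \<noteq> 0" "q_pochhammer p p (Suc M) \<noteq> 0" "q_pochhammer (p / b) p M \<noteq> 0"
    and AM: "A * p ^ Suc M = 1" and c: "b * c = p ^ M" and c1: "c \<noteq> 1"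
  shows "(\<Sum>k\<le>Suc M. hyper_term p A b c k * p ^ (3 * k)) =
         b ^ M * q_pochhammer (p / b) p M ^ 2 / q_pochhammer p p M ^ 2
         * (A * c * (p * z ^ 2 - (1 + p) * b * z + p * b ^ 2 + (p - 1) * (3 - 3 * z - A * c))
         / ((1 - A) ^ 2 * (1 - c) ^ 2))"
proof -
  define T where "T j = (\<Sum>k\<le>Suc M. hyper_term p A b c k * p ^ (j * k))" for j
  define U where "U = b ^ M * q_pochhammer (p / b) p M ^ 2 / q_pochhammer p p M ^ 2"
  have h: "A * b * c * p = 1" using AM c by (simp add: mult_ac)
  have A1: "1 - A \<noteq> 0"
    using assms AM by (auto simp: q_pochhammer_Suc)
  have R0: "(3 - A - b - c) * T 1 + (A * b + A * c + b * c - 3) * T 2 + (1 - A * b * c) * T 3 = 0"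
  proof -
    have "0 = (\<Sum>k\<le>Suc M. hyper_term p A b c k *
           ((1 - A * p ^ k) * (1 - b * p ^ k) * (1 - c * p ^ k) * (\<lambda>_. 1) (Suc k)
             - (1 - p ^ k) ^ 3 * (\<lambda>_. 1) k))"
      by (subst hyper_term_telescope[OF assms(4) AM]) simp
    also have "\<dots> = (3 - A - b - c) * T 1 + (A * b + A * c + b * c - 3) * T 2 + (1 - A * b * c) * T 3"
      unfolding T_def sum_distrib_left sum.distrib[symmetric]
      by (intro sum.cong refl) (simp add: mult.commute[of _ "_::nat"] power_mult; algebra)
    finally show ?thesis by simp
  qed
  have R1: "(p - 1) * T 1 + (3 - p * (A + b + c)) * T 2 + (p * (A * b + A * c + b * c) - 3) * T 3 = 0"
  proof -
    have "0 = (\<Sum>k\<le>Suc M. hyper_term p A b c k *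
           ((1 - A * p ^ k) * (1 - b * p ^ k) * (1 - c * p ^ k) * (\<lambda>k. p ^ k) (Suc k)
             - (1 - p ^ k) ^ 3 * (\<lambda>k. p ^ k) k))"
      by (subst hyper_term_telescope[OF assms(4) AM]) simp
    also have "\<dots> = (p - 1) * T 1 + (3 - p * (A + b + c)) * T 2
        + (p * (A * b + A * c + b * c) - 3) * T 3 + (1 - A * b * c * p) * T 4"
      unfolding T_def sum_distrib_left sum.distrib[symmetric]
      by (intro sum.cong refl) (simp add: mult.commute[of _ "_::nat"] power_mult; algebra)
    finally show ?thesis using h by simp
  qed
  have R2: "T 1 - (A + c) * T 2 + A * c * T 3 = (1 - A) * (1 - c) * U"
  proof -
    have Ap: "inverse (p ^ M) = A * p"
      using AM by (intro inverse_unique) (simp add: mult_ac)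
    have cp: "p ^ Suc M / b = c * p"
      using assms(3) c[symmetric] by simp
    have "(1 - A) * (1 - c) * hyper_term p (A * p) b (c * p) k =
          (1 - A * p ^ k) * ((1 - c * p ^ k) * hyper_term p A b c k)" for k
      by (simp only: mult.assoc mult.left_commute[of "1 - A"] hyper_term_shift_first)
         (simp only: mult.left_commute[of "1 - c"] hyper_term_shift_third)
    note shift = this
    \<comment> \<open>The Saalschuetz sum runs to \<open>M\<close> only; its next term is 0, so it
      can be compared with the sums \<open>T j\<close> up to \<open>Suc M\<close>.\<close>
    have last: "hyper_term p (A * p) b (c * p) (Suc M) = 0"
      using AM by (simp add: hyper_term_def q_pochhammer_Suc mult.assoc)
    have "(1 - A) * (1 - c) * U =
        (1 - A) * (1 - c) * (\<Sum>k\<le>Suc M. hyper_term p (A * p) b (c * p) k * p ^ k)"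
      using q_saalschutz[OF assms(2,3) _ assms(5)] q_pochhammer_nonzero_mono[OF assms(4), of M]
      by (simp add: U_def Ap cp last del: power_Suc)
    also have "\<dots> = T 1 - (A + c) * T 2 + A * c * T 3"
      unfolding T_def sum_distrib_left sum.distrib[symmetric] sum_subtractf[symmetric]
        mult.assoc[symmetric, of _ _ "p ^ _"] shift
      by (intro sum.cong refl) (simp add: mult.commute[of _ "_::nat"] power_mult; algebra)
    finally show ?thesis by simp
  qed
  \<comment> \<open>R2 eliminates \<open>T 1\<close>, with \<open>K\<close> its right-hand side. The
    coefficients of \<open>T 2\<close> and \<open>T 3\<close> become \<alpha>, \<beta> in R1 and
    \<gamma>, \<delta> in R0; in the latter pair \<open>b\<close> cancels.\<close>
  define K \<alpha> \<beta> \<gamma> \<delta> where "K = (1 - A) * (1 - c) * U"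
    and "\<alpha> = 3 - A - c - p * b" and "\<beta> = p * A * b + A * c + p * b * c - 3"
    and "\<gamma> = 3 * A + 3 * c - A ^ 2 - c ^ 2 - A * c - 3" and "\<delta> = 1 - 3 * A * c + A ^ 2 * c + A * c ^ 2"
  have T1: "T 1 = K + (A + c) * T 2 - A * c * T 3"
    using R2 by (simp add: K_def algebra_simps)
  have "(p - 1) * K + \<alpha> * T 2 + \<beta> * T 3 = 0"
    using R1 unfolding T1 \<alpha>_def \<beta>_def by algebra
  moreover have "(3 - A - b - c) * K + \<gamma> * T 2 + \<delta> * T 3 = 0"
    using R0 unfolding T1 \<gamma>_def \<delta>_def by algebra
  ultimately have "(\<beta> * \<gamma> - \<alpha> * \<delta>) * T 3 = ((3 - A - b - c) * \<alpha> - (p - 1) * \<gamma>) * K"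
    by algebra
  \<comment> \<open>The determinant of the 2x2 system factors completely: multiplying by A c makes
    \<open>b\<close> and \<open>p\<close> disappear through A b c p = 1.\<close>
  moreover have "A * c * (\<beta> * \<gamma> - \<alpha> * \<delta>) = (1 - A) ^ 3 * (1 - c) ^ 3"
  proof -
    have "A * c * \<alpha> = A * c * (3 - A - c) - 1" "A * c * \<beta> = A + c + (A * c) ^ 2 - 3 * (A * c)"
      unfolding \<alpha>_def \<beta>_def using h by algebra+
    hence "A * c * (\<beta> * \<gamma> - \<alpha> * \<delta>) =
       (A + c + (A * c) ^ 2 - 3 * (A * c)) * \<gamma> - (A * c * (3 - A - c) - 1) * \<delta>"
      by algebra
    thus ?thesis unfolding \<gamma>_def \<delta>_def by algebra
  qed
  moreover have "(3 - A - b - c) * \<alpha> - (p - 1) * \<gamma> =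
      p * z ^ 2 - (1 + p) * b * z + p * b ^ 2 + (p - 1) * (3 - 3 * z - A * c)"
    unfolding z_def \<alpha>_def \<gamma>_def by algebra
  ultimately have "(1 - A) * (1 - c) * ((1 - A) ^ 2 * (1 - c) ^ 2 * T 3) = (1 - A) * (1 - c) *
      (A * c * (p * z ^ 2 - (1 + p) * b * z + p * b ^ 2 + (p - 1) * (3 - 3 * z - A * c)) * U)"
    unfolding K_def by algebra
  hence "(1 - A) ^ 2 * (1 - c) ^ 2 * T 3 =
      A * c * (p * z ^ 2 - (1 + p) * b * z + p * b ^ 2 + (p - 1) * (3 - 3 * z - A * c)) * U"
    using A1 c1 by simp
  thus ?thesis
    using A1 c1 unfolding T_def[symmetric] U_def[symmetric] by (simp add: field_simps)
qed

section \<open>The deformed sum\<close>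

text \<open>This is F(s, q). The parameter is \<open>s\<close> and not \<open>a\<close>: F is
  polynomial in \<open>s\<close>, and \<sigma> - 2 has a double zero at \<zeta>, so a first-order
  expansion in \<open>s\<close> reaches the precision needed modulo the cube.\<close>

definition deformed_sum :: "nat \<Rightarrow> 'a::field \<Rightarrow> 'a \<Rightarrow> 'a" where
  "deformed_sum N s q = (\<Sum>k\<le>N.
     (\<Prod>j<k. 1 - s * (inverse q * (q ^ 3) ^ j) + (inverse q * (q ^ 3) ^ j) ^ 2) *
     (q_pochhammer (inverse q) (q ^ 3) k / q_pochhammer (q ^ 3) (q ^ 3) k ^ 3 * q ^ (9 * k)))"

lemma deformed_sum_2:
  "deformed_sum N 2 q = (\<Sum>k = 0..N.
     q_pochhammer (inverse q) (q ^ 3) k ^ 3 / q_pochhammer (q ^ 3) (q ^ 3) k ^ 3 * q ^ (9 * k))"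
proof -
  have "(\<Prod>j<k. 1 - 2 * (inverse q * (q ^ 3) ^ j) + (inverse q * (q ^ 3) ^ j) ^ 2) =
        q_pochhammer (inverse q) (q ^ 3) k ^ 2" for k
    unfolding q_pochhammer_def prod_power_distrib
    by (intro prod.cong refl) (simp add: power2_eq_square algebra_simps)
  thus ?thesis
    unfolding deformed_sum_def atMost_atLeast0
    by (intro sum.cong refl) (simp add: power3_eq_cube power2_eq_square)
qed

lemma deformed_sum_eq_hyper_sum:
  assumes "a \<noteq> 0"
  shows "deformed_sum N (a + inverse a) q =
    (\<Sum>k\<le>N. hyper_term (q ^ 3) (inverse q) (inverse q * inverse a) (a * inverse q) k * (q ^ 3) ^ (3 * k))"
proof -
  have "(\<Prod>j<k. 1 - (a + inverse a) * (inverse q * (q ^ 3) ^ j) + (inverse q * (q ^ 3) ^ j) ^ 2) =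
     q_pochhammer (inverse q * inverse a) (q ^ 3) k * q_pochhammer (a * inverse q) (q ^ 3) k" for k
    unfolding q_pochhammer_def prod.distrib[symmetric] using assms
    by (intro prod.cong refl) (simp add: power2_eq_square algebra_simps)
  thus ?thesis
    unfolding deformed_sum_def hyper_term_def
    by (intro sum.cong refl) (simp add: power_mult[symmetric] mult_ac)
qed

section \<open>Closed forms of the deformed sum\<close>

lemma q_pochhammer_nonzero:
  "(\<And>j. j < k \<Longrightarrow> x * q ^ j \<noteq> 1) \<Longrightarrow> q_pochhammer x q k \<noteq> 0"
  by (auto simp: q_pochhammer_def)

text \<open>The exponents that occur are multiples of 3 up to 3 (m + 2) = n + 1, and n is 2 modulo
  3. Exempting the exponent n lets the lemma apply at a primitive n-th root of unity as well as at
  nearby points.\<close>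

lemma q_pochhammer_cube_nonzero:
  fixes q :: "'a::field"
  assumes n: "n = 3 * m + 5"
    and good: "\<And>j. 0 < j \<Longrightarrow> j \<le> n + 1 \<Longrightarrow> j \<noteq> n \<Longrightarrow> q ^ j \<noteq> 1"
    and k: "k \<le> m + 2"
  shows "q_pochhammer (q ^ 3) (q ^ 3) k \<noteq> 0"
proof (rule q_pochhammer_nonzero)
  fix j assume j: "j < k"
  have "3 * Suc j \<noteq> n" unfolding n by presburger
  moreover have "3 * Suc j \<le> n + 1" using j k by (simp add: n)
  ultimately have "q ^ (3 * Suc j) \<noteq> 1" by (intro good) auto
  thus "q ^ 3 * (q ^ 3) ^ j \<noteq> 1" by (simp add: power_mult[symmetric] power_add[symmetric])
qed

lemma one_plus_nonzero: "z ^ 2 \<noteq> 1 \<Longrightarrow> 1 + z \<noteq> 0" for z :: "'a::field"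
proof
  assume "z ^ 2 \<noteq> 1" "1 + z = 0"
  moreover from this have "z = -1" by (simp add: eq_neg_iff_add_eq_0 add.commute)
  ultimately show False by simp
qed

lemma primitive_root_power_neq_one:
  fixes z :: "'a::field"
  assumes z: "z ^ n = 1" and good: "\<And>j. 0 < j \<Longrightarrow> j < n \<Longrightarrow> z ^ j \<noteq> 1" and "1 < n"
    and j: "0 < j" "j \<le> n + 1" "j \<noteq> n"
  shows "z ^ j \<noteq> 1"
proof (cases "j = n + 1")
  case True
  thus ?thesis using z good[of 1] \<open>1 < n\<close> by simp
qed (use j good in auto)

text \<open>The choice a = q^n makes the series terminate for generic \<open>q\<close>, so
  \<open>cubic_hyper_sum\<close> evaluates it exactly. \<open>theta\<close> is what remains of the
  resulting rational factor when a multiple of (1 - q^n)^3 is split off.\<close>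

lemma deformed_sum_power:
  fixes q :: "'a::field"
  assumes n: "n = 3 * m + 5" and q0: "q \<noteq> 0"
    and good: "\<And>j. 0 < j \<Longrightarrow> j \<le> n + 1 \<Longrightarrow> j \<noteq> n \<Longrightarrow> q ^ j \<noteq> 1"
  shows "deformed_sum (m + 2) (q ^ n + inverse (q ^ n)) q =
    inverse q ^ (m + 1) * (1 + q)
     * (q_pochhammer q (q ^ 3) (m + 2) ^ 2 / q_pochhammer (q ^ 3) (q ^ 3) (m + 2) ^ 2)
     * (theta n q + (1 - q ^ n) ^ 3 * (- 1 + 3 * q - 4 * q ^ 3 + 3 * q ^ 4 - q ^ 3 * q ^ n)
         / ((1 + q) * (1 - q) ^ 2 * (q - q ^ n) ^ 2))"
proof -
  \<comment> \<open>Since 3 (m + 2) = n + 1, the parameter 1/(q a) equals p^(-N) and takes the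
    terminating role \<open>A\<close>; the undeformed parameter 1/q becomes
    \<open>b\<close>.\<close>
  define M p Q A b c where "M = m + 1" and "p = q ^ 3" and "Q = q ^ n"
    and "A = inverse q * inverse (q ^ n)" and "b = inverse q" and "c = q ^ n * inverse q"
  note defs = M_def p_def Q_def A_def b_def c_def
  have Q0: "Q \<noteq> 0" using q0 by (simp add: Q_def)
  have qQ: "1 - q * Q \<noteq> 0" using good[of "Suc n"] by (simp add: Q_def)
  have q1: "1 - q \<noteq> 0" using good[of 1] n by simp
  have q2: "1 + q \<noteq> 0" using good[of 2] n by (intro one_plus_nonzero) simp
  have Qq: "Q = q ^ (n - 1) * q" unfolding Q_def using n by (metis Suc_diff_1 add_gr_0 power_Suc2 zero_less_numeral)
  have qQ': "q - Q \<noteq> 0" using good[of "n - 1"] n q0 unfolding Qq by auto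
  have p0: "p \<noteq> 0" using q0 by (simp add: p_def)
  have pp: "p * p ^ j = q ^ (3 * Suc j)" for j by (simp add: p_def power_mult[symmetric] power_add[symmetric])
  have P: "q_pochhammer p p (Suc M) \<noteq> 0"
    unfolding p_def by (rule q_pochhammer_cube_nonzero[OF n good]) (simp_all add: M_def)
  have pb: "p / b = q * p" by (simp add: defs field_simps)
  have P': "q_pochhammer (p / b) p M \<noteq> 0"
  proof (rule q_pochhammer_nonzero)
    fix j assume j: "j < M"
    have "p / b * p ^ j = q * q ^ (3 * Suc j)"
      by (simp only: pb mult.assoc pp)
    also have "\<dots> = q ^ (3 * j + 4)"
      unfolding power_Suc[symmetric] by (rule arg_cong[of _ _ "(^) q"]) simp
    also have "\<dots> \<noteq> 1" by (rule good) (use j n in \<open>auto simp: M_def\<close>)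
    finally show "p / b * p ^ j \<noteq> 1" .
  qed
  have pM: "p ^ M * (q * q) = Q"
    unfolding power2_eq_square[symmetric]
    by (simp add: p_def Q_def M_def n power_mult[symmetric] power_add[symmetric] add.commute)
  have pSM: "p * p ^ M = q * Q"
    using pM by (simp add: p_def power3_eq_cube mult_ac)
  have AM: "A * p ^ Suc M = 1" using q0 Q0 by (simp add: pSM A_def Q_def[symmetric] field_simps)
  have bc: "b * c = p ^ M" using q0 pM by (simp add: b_def c_def Q_def[symmetric] field_simps)
  have c1: "c \<noteq> 1" using qQ' q0 by (auto simp: c_def Q_def field_simps)
  have "deformed_sum (m + 2) (q ^ n + inverse (q ^ n)) q =
      (\<Sum>k\<le>Suc M. hyper_term p A b c k * p ^ (3 * k))"
    using q0 by (subst deformed_sum_eq_hyper_sum) (simp_all add: defs hyper_term_def mult_ac)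
  also have "\<dots> = b ^ M * q_pochhammer (p / b) p M ^ 2 / q_pochhammer p p M ^ 2
         * (A * c * (p * (3 - A - c) ^ 2 - (1 + p) * b * (3 - A - c) + p * b ^ 2
             + (p - 1) * (3 - 3 * (3 - A - c) - A * c))
         / ((1 - A) ^ 2 * (1 - c) ^ 2))"
    by (rule cubic_hyper_sum) (use p0 q0 P P' AM bc c1 in \<open>simp_all add: b_def\<close>)
  also have "A * c * (p * (3 - A - c) ^ 2 - (1 + p) * b * (3 - A - c) + p * b ^ 2
             + (p - 1) * (3 - 3 * (3 - A - c) - A * c)) / ((1 - A) ^ 2 * (1 - c) ^ 2) =
      ((1 - q - 3 * q ^ 2) * (1 - 2 * Q) * (1 - q) ^ 2
        + (4 - 4 * q - 6 * q ^ 2 + 3 * q ^ 3) * Q ^ 2 * (1 - q) ^ 2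
        + (1 - Q) ^ 3 * (- 1 + 3 * q - 4 * q ^ 3 + 3 * q ^ 4 - q ^ 3 * Q)) / ((1 - q * Q) ^ 2 * (q - Q) ^ 2)"
    (is "A * c * ?B / _ = ?E / _")
  proof -
    have AQ: "A * (q * Q) = 1" and cQ: "c * q = Q" and bq: "b * q = 1"
      using q0 Q0 by (simp_all add: defs field_simps)
    \<comment> \<open>Multiplication by (q Q)^2 clears all denominators, because A q Q, b q, A c q^2
      are 1 and c q is Q.\<close>
    have "?B * (q * Q) ^ 2 = ?E"
    proof -
      have z: "(3 - A - c) * (q * Q) = 3 * q * Q - 1 - Q ^ 2" using AQ cQ by algebra
      have "A * c * q ^ 2 * Q = Q" using AQ cQ by algebra
      hence Ac: "A * c * q ^ 2 = 1" using Q0 by simp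
      have "?B * (q * Q) ^ 2 = p * ((3 - A - c) * (q * Q)) ^ 2
          - (1 + p) * (b * q) * Q * ((3 - A - c) * (q * Q))
          + p * (b * q) ^ 2 * Q ^ 2 + (p - 1) * (3 * (q * Q) ^ 2 - 3 * (q * Q) * ((3 - A - c) * (q * Q))
             - (A * c * q ^ 2) * Q ^ 2)"
        by algebra
      also have "\<dots> = ?E" unfolding z Ac bq p_def by (simp add: eval_nat_numeral algebra_simps)
      finally show ?thesis .
    qed
    moreover have "(1 - A) * (q * Q) = - (1 - q * Q)" "(1 - c) * q = q - Q"
      using AQ cQ by algebra+
    moreover have "A * c * q ^ 2 * Q = Q" using AQ cQ by algebra
    hence Ac: "A * c * q ^ 2 = 1" using Q0 by simp
    ultimately have *: "A * c * ?B * ((1 - q * Q) ^ 2 * (q - Q) ^ 2) = ?E * ((1 - A) ^ 2 * (1 - c) ^ 2)"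
      by algebra
    have "1 - A \<noteq> 0" using AQ qQ by auto
    thus ?thesis using * c1 qQ qQ' by (subst frac_eq_eq) auto
  qed
  also have "\<dots> = (1 - q) ^ 2 * (1 + q) / (1 - q * Q) ^ 2 * (theta n q
        + (1 - Q) ^ 3 * (- 1 + 3 * q - 4 * q ^ 3 + 3 * q ^ 4 - q ^ 3 * Q)
           / ((1 + q) * (1 - q) ^ 2 * (q - Q) ^ 2))"
  proof -
    have Q2: "q ^ (2 * n) = Q ^ 2" by (simp add: Q_def power_mult[symmetric] mult.commute)
    define u v where "u = (1 - q - 3 * q ^ 2) * (1 - 2 * Q) + (4 - 4 * q - 6 * q ^ 2 + 3 * q ^ 3) * Q ^ 2"
      and "v = (1 - Q) ^ 3 * (- 1 + 3 * q - 4 * q ^ 3 + 3 * q ^ 4 - q ^ 3 * Q)"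
    define x y w r where "x = (1 - q) ^ 2" and "y = 1 + q" and "w = (q - Q) ^ 2" and "r = (1 - q * Q) ^ 2"
    have "x \<noteq> 0" "y \<noteq> 0" "w \<noteq> 0" "r \<noteq> 0"
      using q1 q2 qQ qQ' by (auto simp: x_def y_def w_def r_def)
    hence "(u * x + v) / (r * w) = x * y / r * (u / (y * w) + v / (y * x * w))"
      by (simp add: field_simps)
    thus ?thesis
      unfolding theta_def Q2 Q_def[symmetric] u_def v_def x_def y_def w_def r_def
      by (simp add: distrib_right)
  qed
  finally have *: "deformed_sum (m + 2) (q ^ n + inverse (q ^ n)) q =
    b ^ M * q_pochhammer (q * p) p M ^ 2 / q_pochhammer p p M ^ 2 *
    ((1 - q) ^ 2 * (1 + q) / (1 - q * Q) ^ 2 * (theta n q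
        + (1 - Q) ^ 3 * (- 1 + 3 * q - 4 * q ^ 3 + 3 * q ^ 4 - q ^ 3 * Q)
           / ((1 + q) * (1 - q) ^ 2 * (q - Q) ^ 2)))" unfolding pb .
  have **: "q_pochhammer q p (m + 2) = (1 - q) * q_pochhammer (q * p) p M"
    using q_pochhammer_Suc_shift[of q p M] by (simp add: M_def)
  have ***: "q_pochhammer p p (m + 2) = q_pochhammer p p M * (1 - q * Q)"
    using q_pochhammer_Suc[of p p M] pSM by (simp add: M_def)
  show ?thesis
    unfolding * unfolding p_def[symmetric] ** *** M_def[symmetric] Q_def[symmetric] b_def
    by (simp add: power_mult_distrib mult_ac)
qed

text \<open>\<open>a\<close> is a root of X^2 - s X + 1; the other root is s - a = 1/a.\<close>

lemma sum_with_inverse_exists: "\<exists>a::complex. a \<noteq> 0 \<and> s = a + inverse a"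
proof -
  define a where "a = (s + csqrt (s ^ 2 - 4)) / 2"
  have "2 * a - s = csqrt (s ^ 2 - 4)" by (simp add: a_def diff_divide_distrib add_divide_distrib)
  hence "(2 * a - s) ^ 2 = s ^ 2 - 4" by simp
  hence "4 * (a * (s - a)) = 4 * 1" by algebra
  hence *: "a * (s - a) = 1" by simp
  hence "a \<noteq> 0" by auto
  moreover from * have "inverse a = s - a" by (rule inverse_unique)
  ultimately show ?thesis by (intro exI[of _ a]) simp
qed

text \<open>q^2 times the bracket in \<open>cubic_hyper_sum\<close> for p = q^3, A = 1/q, b = 1/(q
  a), c = a/q. It is invariant under exchanging a and 1/a, hence a polynomial in s = a +
  1/a.\<close>

definition quadratic_factor :: "'a::field \<Rightarrow> 'a \<Rightarrow> 'a" where
  "quadratic_factor q s = q ^ 3 * (s ^ 2 - 2) - (1 + q ^ 3) * (3 * q - 1) * s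
     + q ^ 3 * (3 * q - 1) ^ 2 + 1 + q ^ 3 + (q ^ 3 - 1) * (3 * q - 6 * q ^ 2)"

text \<open>At a root of unity the undeformed parameter 1/q is itself p^(-N), so the series
  terminates for every \<open>s\<close>. The point is that \<open>C\<close> does not depend on
  \<open>s\<close>, so that the formula can be differentiated in \<open>s\<close>.\<close>

lemma deformed_sum_root_of_unity:
  fixes q :: complex
  assumes n: "n = 3 * m + 5" and q: "q ^ n = 1"
    and good: "\<And>j. 0 < j \<Longrightarrow> j < n \<Longrightarrow> q ^ j \<noteq> 1"
  shows "\<exists>C. \<forall>s. (\<forall>j\<le>m. 1 - s * q ^ (4 + 3 * j) + (q ^ (4 + 3 * j)) ^ 2 \<noteq> 0) \<longrightarrow>
    deformed_sum (m + 2) s q =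
      C * (\<Prod>j<m. 1 - s * q ^ (4 + 3 * j) + (q ^ (4 + 3 * j)) ^ 2) * quadratic_factor q s"
proof -
  define M p t where "M = m + 1" and "p = q ^ 3" and "t = inverse q"
  define \<kappa> where "\<kappa> = (\<Prod>j<m. - inverse (q ^ (4 + 3 * j)))"
  have q0: "q \<noteq> 0" using q n by (auto simp: power_0_left)
  have tq: "t * q = 1" using q0 by (simp add: t_def)
  have p0: "p \<noteq> 0" using q0 by (simp add: p_def)
  have P: "q_pochhammer p p (Suc M) \<noteq> 0"
    unfolding p_def using n
    by (intro q_pochhammer_cube_nonzero[OF n] primitive_root_power_neq_one[OF q good])
      (simp_all add: M_def)
  have qpow: "q ^ (4 + 3 * m) = t"
    using q by (intro inverse_unique[symmetric, of q, folded t_def]) (simp add: n power_add eval_nat_numeral mult_ac)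
  have pM: "p ^ M = t * t"
  proof -
    have "p ^ M * (q * q) = 1"
      using q unfolding power2_eq_square[symmetric]
      by (simp add: p_def M_def n power_mult[symmetric] power_add[symmetric] add.commute)
    moreover have "x = t * t" if "x * (q * q) = 1" for x using that tq by algebra
    ultimately show ?thesis by blast
  qed
  have AM: "t * p ^ Suc M = 1" unfolding power_Suc pM unfolding p_def using tq by algebra
  have "deformed_sum (m + 2) s q = t ^ (m + 5) * \<kappa> / (q_pochhammer p p M ^ 2 * (1 - t) ^ 2)
      * (\<Prod>j<m. 1 - s * q ^ (4 + 3 * j) + (q ^ (4 + 3 * j)) ^ 2) * quadratic_factor q s"
    if s: "\<And>j. j \<le> m \<Longrightarrow> 1 - s * q ^ (4 + 3 * j) + (q ^ (4 + 3 * j)) ^ 2 \<noteq> 0" for s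
  proof -
    obtain a where a0: "a \<noteq> 0" and sa: "s = a + inverse a" using sum_with_inverse_exists by blast
    define b c where "b = t * inverse a" and "c = a * t"
    have fac: "1 - s * x + x ^ 2 = (1 - a * x) * (1 - inverse a * x)" for x
      using a0 by (simp add: sa power2_eq_square algebra_simps)
    have ne: "1 - a * q ^ (4 + 3 * j) \<noteq> 0" if "j \<le> m" for j
      using s[OF that] unfolding fac by auto
    have pb: "p / b * p ^ j = a * q ^ (4 + 3 * j)" for j
    proof -
      have "p / b = a * q ^ 4" by (simp add: b_def t_def p_def field_simps eval_nat_numeral)
      thus ?thesis by (simp add: p_def power_mult power_add)
    qed
    have Y: "q_pochhammer (p / b) p k = (\<Prod>j<k. 1 - a * q ^ (4 + 3 * j))" for k
      by (simp only: q_pochhammer_def pb)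
    have P': "q_pochhammer (p / b) p M \<noteq> 0" unfolding Y using ne by (simp add: M_def)
    have c1: "c \<noteq> 1" using ne[of m] by (simp add: c_def qpow)
    have b0: "b \<noteq> 0" using a0 q0 by (simp add: b_def t_def)
    have bc: "b * c = p ^ M" using a0 by (simp add: b_def c_def pM)
    \<comment> \<open>The factor j = m has exponent n - 1 and equals 1 - c. Splitting it off cancels
      the denominator (1 - c)^2 and leaves the exponents 4, 7, ..., n - 4, a set symmetric under
      negation modulo n.\<close>
    have YM: "q_pochhammer (p / b) p M = (\<Prod>j<m. 1 - a * q ^ (4 + 3 * j)) * (1 - c)"
      unfolding Y M_def by (simp add: qpow[simplified] c_def)
    \<comment> \<open>the exponents \<open>4 + 3 j\<close>, \<open>j < m\<close>, are permuted by negation modulo \<open>n\<close>\<close>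
    have YY: "(\<Prod>j<m. 1 - a * q ^ (4 + 3 * j)) ^ 2 =
        a ^ m * \<kappa> * (\<Prod>j<m. 1 - s * q ^ (4 + 3 * j) + (q ^ (4 + 3 * j)) ^ 2)"
    proof -
      have "(\<Prod>j<m. 1 - a * q ^ (4 + 3 * j)) = (\<Prod>j<m. 1 - a * q ^ (4 + 3 * (m - Suc j)))"
        by (rule prod.nat_diff_reindex[symmetric])
      also have "\<dots> = (\<Prod>j<m. a * (- inverse (q ^ (4 + 3 * j)) * (1 - inverse a * q ^ (4 + 3 * j))))"
      proof (intro prod.cong refl)
        fix j assume j: "j \<in> {..<m}"
        have "q ^ (4 + 3 * (m - Suc j)) * q ^ (4 + 3 * j) = q ^ n"
          unfolding power_add[symmetric] n using j by (intro arg_cong[of _ _ "(^) q"]) simp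
        hence "q ^ (4 + 3 * j) * q ^ (4 + 3 * (m - Suc j)) = 1" using q by (simp add: mult.commute)
        hence "inverse (q ^ (4 + 3 * j)) = q ^ (4 + 3 * (m - Suc j))" by (rule inverse_unique)
        moreover have "q ^ (4 + 3 * j) \<noteq> 0" using q0 by simp
        ultimately show "1 - a * q ^ (4 + 3 * (m - Suc j)) =
            a * (- inverse (q ^ (4 + 3 * j)) * (1 - inverse a * q ^ (4 + 3 * j)))"
          using a0 by (simp only:) (simp add: field_simps)
      qed
      also have "\<dots> = a ^ m * \<kappa> * (\<Prod>j<m. 1 - inverse a * q ^ (4 + 3 * j))"
        by (simp only: prod.distrib \<kappa>_def prod_constant card_lessThan mult.assoc)
      finally have e: "(\<Prod>j<m. 1 - a * q ^ (4 + 3 * j)) =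
          a ^ m * \<kappa> * (\<Prod>j<m. 1 - inverse a * q ^ (4 + 3 * j))" .
      have "(\<Prod>j<m. 1 - a * q ^ (4 + 3 * j)) ^ 2 = (\<Prod>j<m. 1 - a * q ^ (4 + 3 * j)) *
          (a ^ m * \<kappa> * (\<Prod>j<m. 1 - inverse a * q ^ (4 + 3 * j)))"
        unfolding e[symmetric] by (rule power2_eq_square)
      thus ?thesis
        unfolding fac prod.distrib by (simp only: mult_ac)
    qed
    have "deformed_sum (m + 2) s q = (\<Sum>k\<le>Suc M. hyper_term p t b c k * p ^ (3 * k))"
      unfolding sa using a0 by (subst deformed_sum_eq_hyper_sum) (simp_all add: M_def p_def t_def b_def c_def)
    also have "\<dots> = b ^ M * q_pochhammer (p / b) p M ^ 2 / q_pochhammer p p M ^ 2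
         * (t * c * (p * (3 - t - c) ^ 2 - (1 + p) * b * (3 - t - c) + p * b ^ 2
             + (p - 1) * (3 - 3 * (3 - t - c) - t * c))
         / ((1 - t) ^ 2 * (1 - c) ^ 2))"
      by (rule cubic_hyper_sum[OF p0 b0 P P' AM bc c1])
    also have "p * (3 - t - c) ^ 2 - (1 + p) * b * (3 - t - c) + p * b ^ 2
             + (p - 1) * (3 - 3 * (3 - t - c) - t * c) = t ^ 2 * quadratic_factor q s"
    proof -
      have "a * inverse a = 1" using a0 by simp
      thus ?thesis
        using tq unfolding quadratic_factor_def sa b_def c_def p_def by algebra
    qed
    also have "b ^ M * q_pochhammer (p / b) p M ^ 2 / q_pochhammer p p M ^ 2
         * (t * c * (t ^ 2 * quadratic_factor q s) / ((1 - t) ^ 2 * (1 - c) ^ 2)) =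
       (b ^ M * c * a ^ m) * t ^ 3 * \<kappa> / (q_pochhammer p p M ^ 2 * (1 - t) ^ 2)
      * (\<Prod>j<m. 1 - s * q ^ (4 + 3 * j) + (q ^ (4 + 3 * j)) ^ 2) * quadratic_factor q s"
      unfolding YM power_mult_distrib[of _ "1 - c"] YY using c1
      by (simp add: power3_eq_cube power2_eq_square mult_ac)
    \<comment> \<open>All powers of \<open>a\<close> cancel here, which makes the constant
      independent of \<open>s\<close>.\<close>
    also have "b ^ M * c * a ^ m = t ^ (m + 2)"
      using a0 by (simp add: b_def c_def M_def power_mult_distrib power_inverse field_simps)
    also have "t ^ (m + 2) * t ^ 3 = t ^ (m + 5)"
      unfolding power_add[symmetric] by (rule arg_cong[of _ _ "(^) t"]) simp
    finally show ?thesis .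
  qed
  thus ?thesis by blast
qed

section \<open>Behaviour near a primitive root of unity\<close>

text \<open>
  The difference quotient of \<open>f\<close> in its first argument at the moving point \<open>x\<close>, with increment
  \<open>\<sigma> x - s\<close>, converges to the partial derivative at the fixed point \<open>z\<close>.
\<close>

definition same_diff_quotient ::
  "(complex \<Rightarrow> complex) \<Rightarrow> complex \<Rightarrow> complex \<Rightarrow> (complex \<Rightarrow> complex \<Rightarrow> complex) \<Rightarrow> bool" where
  "same_diff_quotient \<sigma> z s f \<longleftrightarrow> (\<exists>d. ((\<lambda>t. f t z) has_field_derivative d) (at s) \<and>
     ((\<lambda>x. (f (\<sigma> x) x - f s x) / (\<sigma> x - s)) \<longlongrightarrow> d) (at z) \<and>
     ((\<lambda>x. f (\<sigma> x) x) \<longlongrightarrow> f s z) (at z) \<and> ((\<lambda>x. f s x) \<longlongrightarrow> f s z) (at z))"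

lemma same_diff_quotient_const:
  "isCont g z \<Longrightarrow> same_diff_quotient \<sigma> z s (\<lambda>_. g)"
  unfolding same_diff_quotient_def by (intro exI[of _ 0]) (auto simp: isCont_def)

lemma same_diff_quotient_param:
  assumes "(\<sigma> \<longlongrightarrow> s) (at z)" "\<forall>\<^sub>F x in at z. \<sigma> x \<noteq> s"
  shows "same_diff_quotient \<sigma> z s (\<lambda>t _. t)"
  unfolding same_diff_quotient_def
proof (intro exI[of _ 1] conjI)
  show "((\<lambda>x. (\<sigma> x - s) / (\<sigma> x - s)) \<longlongrightarrow> 1) (at z)"
    by (rule tendsto_eventually) (use assms(2) in \<open>auto elim: eventually_mono\<close>)
qed (use assms(1) in auto)

lemma same_diff_quotient_add:
  assumes "same_diff_quotient \<sigma> z s f" "same_diff_quotient \<sigma> z s g"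
  shows "same_diff_quotient \<sigma> z s (\<lambda>t x. f t x + g t x)"
proof -
  obtain d e where "((\<lambda>t. f t z) has_field_derivative d) (at s)"
     "((\<lambda>x. (f (\<sigma> x) x - f s x) / (\<sigma> x - s)) \<longlongrightarrow> d) (at z)"
     "((\<lambda>x. f (\<sigma> x) x) \<longlongrightarrow> f s z) (at z)" "((\<lambda>x. f s x) \<longlongrightarrow> f s z) (at z)"
     "((\<lambda>t. g t z) has_field_derivative e) (at s)"
     "((\<lambda>x. (g (\<sigma> x) x - g s x) / (\<sigma> x - s)) \<longlongrightarrow> e) (at z)"
     "((\<lambda>x. g (\<sigma> x) x) \<longlongrightarrow> g s z) (at z)" "((\<lambda>x. g s x) \<longlongrightarrow> g s z) (at z)"
    using assms unfolding same_diff_quotient_def by blast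
  note * = this
  show ?thesis
    unfolding same_diff_quotient_def
  proof (intro exI[of _ "d + e"] conjI)
    show "((\<lambda>x. (f (\<sigma> x) x + g (\<sigma> x) x - (f s x + g s x)) / (\<sigma> x - s)) \<longlongrightarrow> d + e) (at z)"
      using tendsto_add[OF *(2,6)] by (simp add: add_divide_distrib diff_divide_distrib algebra_simps)
  qed (intro DERIV_add tendsto_add *)+
qed

lemma same_diff_quotient_mult:
  assumes "same_diff_quotient \<sigma> z s f" "same_diff_quotient \<sigma> z s g"
  shows "same_diff_quotient \<sigma> z s (\<lambda>t x. f t x * g t x)"
proof -
  obtain d e where "((\<lambda>t. f t z) has_field_derivative d) (at s)"
     "((\<lambda>x. (f (\<sigma> x) x - f s x) / (\<sigma> x - s)) \<longlongrightarrow> d) (at z)"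
     "((\<lambda>x. f (\<sigma> x) x) \<longlongrightarrow> f s z) (at z)" "((\<lambda>x. f s x) \<longlongrightarrow> f s z) (at z)"
     "((\<lambda>t. g t z) has_field_derivative e) (at s)"
     "((\<lambda>x. (g (\<sigma> x) x - g s x) / (\<sigma> x - s)) \<longlongrightarrow> e) (at z)"
     "((\<lambda>x. g (\<sigma> x) x) \<longlongrightarrow> g s z) (at z)" "((\<lambda>x. g s x) \<longlongrightarrow> g s z) (at z)"
    using assms unfolding same_diff_quotient_def by blast
  note * = this
  have "(f (\<sigma> x) x * g (\<sigma> x) x - f s x * g s x) / (\<sigma> x - s) =
      (f (\<sigma> x) x - f s x) / (\<sigma> x - s) * g (\<sigma> x) x + (g (\<sigma> x) x - g s x) / (\<sigma> x - s) * f s x" for x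
    by (simp add: divide_inverse algebra_simps)
  thus ?thesis
    unfolding same_diff_quotient_def
    using DERIV_mult[OF *(1,5)] tendsto_add[OF tendsto_mult[OF *(2,7)] tendsto_mult[OF *(6,4)]]
      tendsto_mult[OF *(3,7)] tendsto_mult[OF *(4,8)]
    by auto
qed

lemma same_diff_quotient_diff:
  assumes "same_diff_quotient \<sigma> z s f" "same_diff_quotient \<sigma> z s g"
  shows "same_diff_quotient \<sigma> z s (\<lambda>t x. f t x - g t x)"
  using same_diff_quotient_add[OF assms(1)
      same_diff_quotient_mult[OF same_diff_quotient_const[where g = "\<lambda>_. -1"] assms(2)]]
  by simp

lemma same_diff_quotient_sum:
  assumes "\<And>i. i \<in> I \<Longrightarrow> same_diff_quotient \<sigma> z s (f i)"
  shows "same_diff_quotient \<sigma> z s (\<lambda>t x. \<Sum>i\<in>I. f i t x)"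
  using assms
  by (induction I rule: infinite_finite_induct)
    (auto intro: same_diff_quotient_add same_diff_quotient_const)

lemma same_diff_quotient_prod:
  assumes "\<And>i. i \<in> I \<Longrightarrow> same_diff_quotient \<sigma> z s (f i)"
  shows "same_diff_quotient \<sigma> z s (\<lambda>t x. \<Prod>i\<in>I. f i t x)"
  using assms
  by (induction I rule: infinite_finite_induct)
    (auto intro: same_diff_quotient_mult same_diff_quotient_const)

lemma isCont_q_pochhammer:
  fixes f g :: "complex \<Rightarrow> complex"
  shows "isCont f z \<Longrightarrow> isCont g z \<Longrightarrow> isCont (\<lambda>x. q_pochhammer (f x) (g x) k) z"
  unfolding q_pochhammer_def by (intro continuous_intros)

text \<open>F is built by sums and products from the parameter \<open>s\<close> and functions of
  \<open>q\<close> continuous at \<open>z\<close>, and the property is closed under these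
  operations.\<close>

lemma same_diff_quotient_deformed_sum:
  fixes z :: complex
  assumes "(\<sigma> \<longlongrightarrow> s) (at z)" "\<forall>\<^sub>F x in at z. \<sigma> x \<noteq> s"
    and z0: "z \<noteq> 0" and P: "q_pochhammer (z ^ 3) (z ^ 3) N \<noteq> 0"
  shows "same_diff_quotient \<sigma> z s (deformed_sum N)"
proof -
  have X: "isCont (\<lambda>x. inverse x * (x ^ 3) ^ j) z" for j
    using z0 by (intro continuous_intros)
  have rest: "isCont (\<lambda>x. q_pochhammer (inverse x) (x ^ 3) k / q_pochhammer (x ^ 3) (x ^ 3) k ^ 3
        * x ^ (9 * k)) z" if "k \<in> {..N}" for k
  proof -
    have "q_pochhammer (z ^ 3) (z ^ 3) k ^ 3 \<noteq> 0"
      using q_pochhammer_nonzero_mono[OF P] that by simp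
    thus ?thesis using z0 by (intro continuous_intros isCont_q_pochhammer) auto
  qed
  have factor: "same_diff_quotient \<sigma> z s (\<lambda>t x. 1 - t * (inverse x * (x ^ 3) ^ j)
      + (inverse x * (x ^ 3) ^ j) ^ 2)" for j
    by (intro same_diff_quotient_add[OF same_diff_quotient_diff[OF same_diff_quotient_const
          same_diff_quotient_mult[OF same_diff_quotient_param[OF assms(1,2)] same_diff_quotient_const]]
        same_diff_quotient_const] continuous_power X continuous_const)
  have "same_diff_quotient \<sigma> z s (\<lambda>t x. deformed_sum N t x)"
    unfolding deformed_sum_def
    by (rule same_diff_quotient_sum, rule same_diff_quotient_mult,
        rule same_diff_quotient_prod, rule factor, rule same_diff_quotient_const, rule rest)
  thus ?thesis by simp
qed

section \<open>Value and derivative at a primitive root of unity\<close>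

definition prefactor :: "nat \<Rightarrow> 'a::field \<Rightarrow> 'a" where
  "prefactor m q = inverse q ^ (m + 1) * (1 + q)
     * (q_pochhammer q (q ^ 3) (m + 2) ^ 2 / q_pochhammer (q ^ 3) (q ^ 3) (m + 2) ^ 2)"

definition correction :: "nat \<Rightarrow> 'a::field \<Rightarrow> 'a" where
  "correction m q = (\<Sum>i = 1..m + 2. 3 * q ^ (3 * i - 2) / q_int q (3 * i - 2) ^ 2)
     - (1 + 5 * q + 3 * q ^ 2) / (1 + q)"

text \<open>This value normalises the unknown constant \<open>C\<close> in the closed form at the
  root of unity.\<close>

lemma theta_root_of_unity:
  fixes z :: "'a::field"
  assumes "z ^ n = 1" "z \<noteq> 1" "1 + z \<noteq> 0"
  shows "theta n z = 3"
proof -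
  have "z ^ (2 * n) = 1" using assms(1) by (simp add: power_mult mult.commute[of 2])
  moreover have "(1 - z - 3 * z ^ 2) * (1 - 2 * 1) + (4 - 4 * z - 6 * z ^ 2 + 3 * z ^ 3) * 1 =
      3 * ((1 + z) * (z - 1) ^ 2)" by algebra
  ultimately show ?thesis using assms by (simp add: theta_def)
qed

lemma sum_inverse_diff_two:
  fixes y :: "'a::field"
  shows "y \<noteq> 0 \<Longrightarrow> y + inverse y - 2 = (1 - y) ^ 2 / y"
  by (simp add: field_simps power2_eq_square)

text \<open>The exponents 3i - 2 run through 1, 4, ..., n - 1. The two extreme ones contribute
  equally and merge with the rational term; the inner ones are the exponents of the product in
  \<open>deformed_sum_root_of_unity\<close>. The result has the shape of a logarithmic derivative of
  the closed form there.\<close>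

lemma correction_root_of_unity:
  fixes z :: complex
  assumes n: "n = 3 * m + 5" and z: "z ^ n = 1"
    and good: "\<And>j. 0 < j \<Longrightarrow> j < n \<Longrightarrow> z ^ j \<noteq> 1"
  shows "correction m z / (1 - z) ^ 2 = 3 * (\<Sum>j<m. z ^ (4 + 3 * j) / (1 - z ^ (4 + 3 * j)) ^ 2)
     - (1 - z - 3 * z ^ 2) / ((1 - z) ^ 2 * (1 + z))"
proof -
  define G where "G j = z ^ j / (1 - z ^ j) ^ 2" for j
  have z1: "1 - z \<noteq> 0" using good[of 1] n by simp
  have z2: "1 + z \<noteq> 0" using good[of 2] n by (intro one_plus_nonzero) simp
  have "3 * z ^ i / q_int z i ^ 2 = (1 - z) ^ 2 * (3 * G i)" for i
    using z1 by (simp add: q_int_def G_def power_divide)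
  hence "(\<Sum>i = 1..m + 2. 3 * z ^ (3 * i - 2) / q_int z (3 * i - 2) ^ 2) =
      (1 - z) ^ 2 * (3 * (\<Sum>i = 1..m + 2. G (3 * i - 2)))"
    by (simp only: sum_distrib_left)
  also have "(\<Sum>i = 1..m + 2. G (3 * i - 2)) = (\<Sum>i<m + 2. G (3 * i + 1))"
    by (rule sum.reindex_bij_witness[of _ Suc "\<lambda>i. i - 1"]) (auto intro!: arg_cong[of _ _ G])
  also have "\<dots> = G 1 + (\<Sum>j<m. G (4 + 3 * j)) + G (4 + 3 * m)"
    using sum.lessThan_Suc_shift[of "\<lambda>i. G (3 * i + 1)" m]
    by (simp add: add_ac)
  \<comment> \<open>w/(1 - w)^2 is unchanged when w is replaced by 1/w, and 4 + 3m = n - 1.\<close>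
  also have "G (4 + 3 * m) = G 1"
  proof -
    have "z * z ^ (4 + 3 * m) = 1" using z by (simp add: n power_add eval_nat_numeral mult_ac)
    moreover have "w / (1 - w) ^ 2 = z / (1 - z) ^ 2" if w: "z * w = 1" for w
    proof (subst frac_eq_eq)
      show "w * (1 - z) ^ 2 = z * (1 - w) ^ 2" using w by algebra
    qed (use w z1 in auto)
    ultimately show ?thesis unfolding G_def by simp
  qed
  finally have "correction m z = (1 - z) ^ 2 * (3 * (\<Sum>j<m. G (4 + 3 * j)) + 6 * z / (1 - z) ^ 2)
      - (1 + 5 * z + 3 * z ^ 2) / (1 + z)"
    by (simp add: correction_def G_def algebra_simps)
  hence "correction m z / (1 - z) ^ 2 = 3 * (\<Sum>j<m. G (4 + 3 * j)) + 6 * z / (1 - z) ^ 2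
      - (1 + 5 * z + 3 * z ^ 2) / (1 + z) / (1 - z) ^ 2"
    using z1 by (simp add: diff_divide_distrib)
  also have "\<dots> = 3 * (\<Sum>j<m. G (4 + 3 * j)) - (1 - z - 3 * z ^ 2) / ((1 - z) ^ 2 * (1 + z))"
  proof -
    have "6 * z / (1 - z) ^ 2 - (1 + 5 * z + 3 * z ^ 2) / (1 + z) / (1 - z) ^ 2 =
        (6 * z * (1 + z) - (1 + 5 * z + 3 * z ^ 2)) / ((1 - z) ^ 2 * (1 + z))"
      using z1 z2 by (simp add: diff_divide_distrib mult.commute)
    also have "6 * z * (1 + z) - (1 + 5 * z + 3 * z ^ 2) = - (1 - z - 3 * z ^ 2)" by algebra
    finally have e: "6 * z / (1 - z) ^ 2 - (1 + 5 * z + 3 * z ^ 2) / (1 + z) / (1 - z) ^ 2 =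
        - ((1 - z - 3 * z ^ 2) / ((1 - z) ^ 2 * (1 + z)))" by (simp only: minus_divide_left)
    show ?thesis by (simp only: add_diff_eq[symmetric] e add_uminus_conv_diff)
  qed
  finally show ?thesis by (simp add: G_def)
qed

text \<open>Differentiate the closed form C V(s) W(s), with W the quadratic factor, at s = 2. The
  constant is eliminated by the known value 3p, where \<open>p\<close> now stands for the prefactor
  at \<open>z\<close> and not for a cube.\<close>

lemma deformed_sum_deriv:
  fixes z :: complex
  assumes n: "n = 3 * m + 5" and z: "z ^ n = 1"
    and good: "\<And>j. 0 < j \<Longrightarrow> j < n \<Longrightarrow> z ^ j \<noteq> 1"
    and val: "deformed_sum (m + 2) 2 z = 3 * p"
    and d: "((\<lambda>s. deformed_sum (m + 2) s z) has_field_derivative d) (at 2)"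
  shows "d = - p * (correction m z / (1 - z) ^ 2)"
proof -
  define y where "y j = z ^ (4 + 3 * j)" for j
  define V where "V s = (\<Prod>j<m. 1 - s * y j + y j ^ 2)" for s
  have z1: "1 - z \<noteq> 0" using good[of 1] n by simp
  have z2: "1 + z \<noteq> 0" using good[of 2] n by (intro one_plus_nonzero) simp
  have y1: "y j \<noteq> 1" if "j \<le> m" for j
    unfolding y_def by (rule good) (use that n in auto)
  have at2: "1 - 2 * y j + y j ^ 2 = (1 - y j) ^ 2" for j
    by (simp add: power2_eq_square algebra_simps)
  obtain C where C: "\<And>s. (\<And>j. j \<le> m \<Longrightarrow> 1 - s * y j + y j ^ 2 \<noteq> 0) \<Longrightarrow>
      deformed_sum (m + 2) s z = C * V s * quadratic_factor z s"
    using deformed_sum_root_of_unity[OF n z good] unfolding y_def V_def by blast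
  \<comment> \<open>The closed form holds away from the zeros of these factors. At s = 2 they are
    the nonzero squares (1 - y)^2, so it holds in a neighbourhood of 2.\<close>
  have "\<forall>\<^sub>F s in nhds 2. \<forall>j\<in>{..m}. 1 - s * y j + y j ^ 2 \<noteq> 0"
  proof (intro eventually_ball_finite ballI)
    fix j assume "j \<in> {..m}"
    hence j: "j \<le> m" by simp
    have "isCont (\<lambda>s. 1 - s * y j + y j ^ 2) 2" by (intro continuous_intros)
    hence "((\<lambda>s. 1 - s * y j + y j ^ 2) \<longlongrightarrow> 1 - 2 * y j + y j ^ 2) (nhds 2)"
      by (simp add: isCont_def tendsto_nhds_iff)
    thus "\<forall>\<^sub>F s in nhds 2. 1 - s * y j + y j ^ 2 \<noteq> 0"
      by (rule tendsto_imp_eventually_ne) (use y1[OF j] in \<open>simp add: at2\<close>)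
  qed auto
  hence ev: "\<forall>\<^sub>F s in nhds 2. deformed_sum (m + 2) s z = C * V s * quadratic_factor z s"
    by eventually_elim (use C in auto)
  have CV: "C * V 2 * quadratic_factor z 2 = 3 * p"
    using eventually_nhds_x_imp_x[OF ev] val by simp
  have W2: "quadratic_factor z 2 = 3 * (1 - z) ^ 4 * (1 + z)"
    unfolding quadratic_factor_def by algebra
  have W2': "quadratic_factor z 2 \<noteq> 0" unfolding W2 using z1 z2 by simp
  have V': "(V has_field_derivative V 2 * (\<Sum>j<m. - y j / (1 - 2 * y j + y j ^ 2))) (at 2)"
    unfolding V_def
    by (rule has_field_derivative_prod') (use y1 in \<open>auto simp: at2 intro!: derivative_eq_intros\<close>)
  have W': "(quadratic_factor z has_field_derivative (1 - z) ^ 2 * (1 - z - 3 * z ^ 2)) (at 2)"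
    unfolding quadratic_factor_def [abs_def]
    by (rule derivative_eq_intros refl | simp)+ algebra
  have "((\<lambda>s. C * V s * quadratic_factor z s) has_field_derivative
     C * (V 2 * (\<Sum>j<m. - y j / (1 - 2 * y j + y j ^ 2))) * quadratic_factor z 2
       + (1 - z) ^ 2 * (1 - z - 3 * z ^ 2) * (C * V 2)) (at 2)"
    by (intro DERIV_mult DERIV_cmult V' W')
  moreover have "((\<lambda>s. C * V s * quadratic_factor z s) has_field_derivative d) (at 2)"
    using d DERIV_cong_ev[OF refl ev refl] by blast
  ultimately have "d = C * (V 2 * (\<Sum>j<m. - y j / (1 - 2 * y j + y j ^ 2))) * quadratic_factor z 2
       + (1 - z) ^ 2 * (1 - z - 3 * z ^ 2) * (C * V 2)"
    using DERIV_unique by blast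
  also have "\<dots> = 3 * p * (\<Sum>j<m. - y j / (1 - 2 * y j + y j ^ 2))
      + (1 - z) ^ 2 * (1 - z - 3 * z ^ 2) * (C * V 2)"
    unfolding CV[symmetric] by (simp add: mult_ac)
  also have "C * V 2 = p / ((1 - z) ^ 4 * (1 + z))"
  proof -
    have "3 * (C * V 2 * ((1 - z) ^ 4 * (1 + z))) = 3 * p"
      using CV unfolding W2 by (simp only: mult_ac)
    hence "C * V 2 * ((1 - z) ^ 4 * (1 + z)) = p" by simp
    thus ?thesis using z1 z2 by (subst nonzero_eq_divide_eq) auto
  qed
  also have "(1 - z) ^ 2 * (1 - z - 3 * z ^ 2) * (p / ((1 - z) ^ 4 * (1 + z))) =
      p * ((1 - z - 3 * z ^ 2) / ((1 - z) ^ 2 * (1 + z)))"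
    using z1 by (simp add: power4_eq_xxxx power2_eq_square mult_ac)
  also have "(\<Sum>j<m. - y j / (1 - 2 * y j + y j ^ 2)) = - (\<Sum>j<m. y j / (1 - y j) ^ 2)"
    by (simp add: at2 sum_negf)
  finally have "d = - p * (3 * (\<Sum>j<m. y j / (1 - y j) ^ 2)
      - (1 - z - 3 * z ^ 2) / ((1 - z) ^ 2 * (1 + z)))"
    by (simp only: right_diff_distrib) simp
  thus ?thesis
    by (subst correction_root_of_unity[OF n z good]) (auto simp: y_def)
qed

section \<open>The difference of both sides near a primitive root of unity\<close>

lemma eventually_at_notin_finite:
  fixes z :: "'a::t1_space"
  assumes "finite S"
  shows "\<forall>\<^sub>F x in at z. x \<notin> S"
proof -
  have "open (- (S - {z}))" using assms by (intro open_Compl finite_imp_closed) auto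
  thus ?thesis
    unfolding eventually_at_topological by (intro exI[of _ "- (S - {z})"] conjI) auto
qed

lemma difference_limit:
  fixes z :: complex
  assumes n: "n = 3 * m + 5" and z: "z ^ n = 1"
    and good: "\<And>j. 0 < j \<Longrightarrow> j < n \<Longrightarrow> z ^ j \<noteq> 1"
  shows "((\<lambda>x. (deformed_sum (m + 2) 2 x - prefactor m x * (theta n x + q_int x n ^ 2 * correction m x))
            / (x - z) ^ 2) \<longlongrightarrow> 0) (at z)"
proof -
  define \<sigma> where "\<sigma> x = x ^ n + inverse (x ^ n)" for x :: complex
  define h where "h x = (- 1 + 3 * x - 4 * x ^ 3 + 3 * x ^ 4 - x ^ 3 * x ^ n)
         / ((1 + x) * (1 - x) ^ 2 * (x - x ^ n) ^ 2)" for x :: complex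
  define \<delta> where "\<delta> x = (deformed_sum (m + 2) (\<sigma> x) x - deformed_sum (m + 2) 2 x) / (\<sigma> x - 2)" for x
  have z0: "z \<noteq> 0" using z n by (auto simp: power_0_left)
  have z1: "z \<noteq> 1" using good[of 1] n by simp
  have good': "z ^ j \<noteq> 1" if "0 < j" "j \<le> n + 1" "j \<noteq> n" for j
    using that n by (intro primitive_root_power_neq_one[OF z good]) auto
  have z2: "1 + z \<noteq> 0" using good[of 2] n by (intro one_plus_nonzero) simp
  have P: "q_pochhammer (z ^ 3) (z ^ 3) (m + 2) \<noteq> 0"
    by (rule q_pochhammer_cube_nonzero[OF n good']) simp_all
  have \<sigma>2: "\<sigma> x - 2 = (1 - x ^ n) ^ 2 / x ^ n" if "x \<noteq> 0" for x
    unfolding \<sigma>_def by (rule sum_inverse_diff_two) (use that in simp)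
  have "isCont \<sigma> z" unfolding \<sigma>_def [abs_def] using z0 by (intro continuous_intros) auto
  hence \<sigma>_lim: "(\<sigma> \<longlongrightarrow> 2) (at z)" using z by (simp add: isCont_def \<sigma>_def)
  have ev_ne: "\<forall>\<^sub>F x in at z. x ^ n \<noteq> 1"
    using eventually_at_notin_finite[of "{x. x ^ n = 1}" z] finite_roots_unity[of n] n by simp
  have ev_0: "\<forall>\<^sub>F x in at z. x \<noteq> 0"
    using tendsto_imp_eventually_ne[OF tendsto_ident_at z0] .
  have ev_good: "\<forall>\<^sub>F x in at z. \<forall>j\<in>{1..n + 1} - {n}. x ^ j \<noteq> 1"
  proof (intro eventually_ball_finite ballI)
    fix j assume "j \<in> {1..n + 1} - {n}"
    hence "z ^ j \<noteq> 1" by (intro good') auto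
    moreover have "((\<lambda>x. x ^ j) \<longlongrightarrow> z ^ j) (at z)" by (intro tendsto_intros)
    ultimately show "\<forall>\<^sub>F x in at z. x ^ j \<noteq> 1" by (rule tendsto_imp_eventually_ne[rotated])
  qed auto
  have \<sigma>_ne: "\<forall>\<^sub>F x in at z. \<sigma> x \<noteq> 2"
    using ev_ne ev_0
  proof eventually_elim
    case (elim x)
    hence "\<sigma> x - 2 \<noteq> 0" unfolding \<sigma>2[OF elim(2)] by simp
    thus ?case by simp
  qed
  have power: "deformed_sum (m + 2) (\<sigma> x) x = prefactor m x * (theta n x + (1 - x ^ n) ^ 3 * h x)"
    if "x \<noteq> 0" "\<forall>j\<in>{1..n + 1} - {n}. x ^ j \<noteq> 1" for x
  proof -
    have h: "(1 - x ^ n) ^ 3 * h x = (1 - x ^ n) ^ 3 * (- 1 + 3 * x - 4 * x ^ 3 + 3 * x ^ 4 - x ^ 3 * x ^ n)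
         / ((1 + x) * (1 - x) ^ 2 * (x - x ^ n) ^ 2)"
      by (simp add: h_def)
    show ?thesis
      unfolding \<sigma>_def h prefactor_def
      by (rule deformed_sum_power[OF n that(1)]) (use that(2) in auto)
  qed
  \<comment> \<open>The exact evaluation is also valid at x = z, where \<sigma> takes the value 2
    and the cubic remainder vanishes.\<close>
  have val: "deformed_sum (m + 2) 2 z = 3 * prefactor m z"
    using power[OF z0] good' z by (simp add: \<sigma>_def theta_root_of_unity[OF z z1 z2])
  obtain d where d: "((\<lambda>s. deformed_sum (m + 2) s z) has_field_derivative d) (at 2)"
    and \<delta>_lim: "(\<delta> \<longlongrightarrow> d) (at z)"
    using same_diff_quotient_deformed_sum[OF \<sigma>_lim \<sigma>_ne z0 P]
    unfolding same_diff_quotient_def \<delta>_def [abs_def] by blast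
  have deriv: "d = - prefactor m z * (correction m z / (1 - z) ^ 2)"
    by (rule deformed_sum_deriv[OF n z good val d])
  \<comment> \<open>\<open>R\<close> is the difference of both sides divided by (1 - x^n)^2: the
    correction term brings 1/(1 - x)^2 from [n]^2, and the term in \<open>\<delta>\<close> comes
    from (\<sigma> - 2) \<delta>. Its limit is 0 by the value of \<open>d\<close>.\<close>
  define R where "R x = prefactor m x * ((1 - x ^ n) * h x - correction m x / (1 - x) ^ 2) - \<delta> x / x ^ n" for x
  have "isCont (prefactor m) z"
    unfolding prefactor_def [abs_def] using z0 P
    by (intro continuous_intros isCont_q_pochhammer) auto
  moreover have "isCont h z"
    unfolding h_def [abs_def] using z z1 z2 by (intro continuous_intros) auto
  moreover have "isCont (correction m) z"
  proof -
    have "q_int z (3 * i - 2) ^ 2 \<noteq> 0" if "i \<in> {1..m + 2}" for i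
    proof -
      have "0 < 3 * i - 2" "3 * i - 2 < n" using that unfolding n by auto
      thus ?thesis using good[of "3 * i - 2"] z1 by (simp add: q_int_def)
    qed
    moreover have "isCont (\<lambda>x. q_int x j) z" for j
      unfolding q_int_def using z1 by (intro continuous_intros) auto
    ultimately show ?thesis
      unfolding correction_def [abs_def] using z2
      by (intro continuous_intros) auto
  qed
  ultimately have "(R \<longlongrightarrow> prefactor m z * ((1 - z ^ n) * h z - correction m z / (1 - z) ^ 2) - d / z ^ n) (at z)"
    unfolding R_def [abs_def] isCont_def using z0 z1 by (intro tendsto_intros \<delta>_lim) auto
  hence R_lim: "(R \<longlongrightarrow> 0) (at z)" by (simp add: z deriv)
  \<comment> \<open>Since z^n = 1, this derivative is the limit of (1 - x^n)/(x - z), so (1 - x^n)^2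
    absorbs the denominator (x - z)^2.\<close>
  have "((\<lambda>x. 1 - x ^ n) has_field_derivative - (of_nat n * z ^ (n - 1))) (at z)"
    by (auto intro!: derivative_eq_intros)
  hence "((\<lambda>x. (1 - x ^ n) / (x - z)) \<longlongrightarrow> - (of_nat n * z ^ (n - 1))) (at z)"
    by (simp add: has_field_derivative_iff z)
  from tendsto_mult[OF tendsto_power[OF this, of 2] R_lim]
  have "((\<lambda>x. ((1 - x ^ n) / (x - z)) ^ 2 * R x) \<longlongrightarrow> 0) (at z)" by simp
  moreover have "\<forall>\<^sub>F x in at z. ((1 - x ^ n) / (x - z)) ^ 2 * R x =
     (deformed_sum (m + 2) 2 x - prefactor m x * (theta n x + q_int x n ^ 2 * correction m x)) / (x - z) ^ 2"
    using ev_ne ev_0 ev_good \<sigma>_ne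
  proof eventually_elim
    case (elim x)
    have "(1 - x ^ n) ^ 2 * (\<delta> x / x ^ n) = (\<sigma> x - 2) * \<delta> x"
      using \<sigma>2[OF elim(2)] by simp
    also have "\<dots> = deformed_sum (m + 2) (\<sigma> x) x - deformed_sum (m + 2) 2 x"
      using elim(4) by (simp add: \<delta>_def)
    finally have "deformed_sum (m + 2) 2 x = prefactor m x * (theta n x + (1 - x ^ n) ^ 3 * h x)
        - (1 - x ^ n) ^ 2 * (\<delta> x / x ^ n)"
      using power[OF elim(2,3)] by simp
    moreover have "q_int x n ^ 2 * correction m x = (1 - x ^ n) ^ 2 * (correction m x / (1 - x) ^ 2)"
      by (simp add: q_int_def power_divide)
    ultimately have "deformed_sum (m + 2) 2 x
        - prefactor m x * (theta n x + q_int x n ^ 2 * correction m x) = (1 - x ^ n) ^ 2 * R x"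
    proof -
      have gen: "p * (t + w ^ 3 * a) - w ^ 2 * k - p * (t + w ^ 2 * c) = w ^ 2 * (p * (w * a - c) - k)"
        for p t w a k c :: complex by algebra
      assume "deformed_sum (m + 2) 2 x = prefactor m x * (theta n x + (1 - x ^ n) ^ 3 * h x)
          - (1 - x ^ n) ^ 2 * (\<delta> x / x ^ n)"
        "q_int x n ^ 2 * correction m x = (1 - x ^ n) ^ 2 * (correction m x / (1 - x) ^ 2)"
      thus ?thesis unfolding R_def by (simp only: gen)
    qed
    thus ?case by (simp add: power_divide)
  qed
  ultimately show ?thesis by (rule Lim_transform_eventually)
qed

section \<open>Rational functions near a complex point\<close>

abbreviation cpoly :: "int poly \<Rightarrow> complex poly" where
  "cpoly \<equiv> map_poly of_int"

text \<open>\<open>f\<close> is the complex function given by the rational function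
  \<open>A\<close>, regular at \<open>z\<close>. Equality is required on a full neighbourhood
  including \<open>z\<close>, so that \<open>f z\<close> is the true value and
  \<open>f z \<noteq> 0\<close> permits inversion.\<close>

definition represents_near :: "complex \<Rightarrow> int poly fract \<Rightarrow> (complex \<Rightarrow> complex) \<Rightarrow> bool" where
  "represents_near z A f \<longleftrightarrow> (\<exists>u v. A = Fract u v \<and> poly (cpoly v) z \<noteq> 0 \<and>
     (\<forall>\<^sub>F x in nhds z. f x = poly (cpoly u) x / poly (cpoly v) x))"

lemma eventually_poly_nonzero:
  fixes p :: "complex poly"
  assumes "poly p z \<noteq> 0"
  shows "\<forall>\<^sub>F x in nhds z. poly p x \<noteq> 0"
proof -
  have "isCont (poly p) z" by simp
  hence "(poly p \<longlongrightarrow> poly p z) (nhds z)" by (simp add: isCont_def tendsto_nhds_iff)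
  thus ?thesis using assms by (rule tendsto_imp_eventually_ne)
qed

lemma represents_near_var: "represents_near z ratfun_var (\<lambda>x. x)"
  unfolding represents_near_def ratfun_var_def to_fract_def
  by (intro exI[of _ "[:0, 1:]"] exI[of _ 1]) (simp add: map_poly_pCons map_poly_1)

lemma represents_near_add:
  assumes "represents_near z A f" "represents_near z B g"
  shows "represents_near z (A + B) (\<lambda>x. f x + g x)"
proof -
  obtain u v u' v' where *: "A = Fract u v" "poly (cpoly v) z \<noteq> 0"
     "\<forall>\<^sub>F x in nhds z. f x = poly (cpoly u) x / poly (cpoly v) x"
     "B = Fract u' v'" "poly (cpoly v') z \<noteq> 0"
     "\<forall>\<^sub>F x in nhds z. g x = poly (cpoly u') x / poly (cpoly v') x"
    using assms unfolding represents_near_def by blast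
  have "v \<noteq> 0" "v' \<noteq> 0" using *(2,5) by auto
  hence "A + B = Fract (u * v' + u' * v) (v * v')" using * by simp
  moreover have "poly (cpoly (v * v')) z \<noteq> 0" using * by (simp add: of_int_poly_mult)
  moreover have "\<forall>\<^sub>F x in nhds z. f x + g x =
      poly (cpoly (u * v' + u' * v)) x / poly (cpoly (v * v')) x"
    using *(3,6) eventually_poly_nonzero[OF *(2)] eventually_poly_nonzero[OF *(5)]
    by eventually_elim (simp add: of_int_poly_mult of_int_poly_add add_frac_eq)
  ultimately show ?thesis unfolding represents_near_def by blast
qed

lemma represents_near_mult:
  assumes "represents_near z A f" "represents_near z B g"
  shows "represents_near z (A * B) (\<lambda>x. f x * g x)"
proof -
  obtain u v u' v' where *: "A = Fract u v" "poly (cpoly v) z \<noteq> 0"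
     "\<forall>\<^sub>F x in nhds z. f x = poly (cpoly u) x / poly (cpoly v) x"
     "B = Fract u' v'" "poly (cpoly v') z \<noteq> 0"
     "\<forall>\<^sub>F x in nhds z. g x = poly (cpoly u') x / poly (cpoly v') x"
    using assms unfolding represents_near_def by blast
  have "A * B = Fract (u * u') (v * v')" using * by simp
  moreover have "poly (cpoly (v * v')) z \<noteq> 0" using * by (simp add: of_int_poly_mult)
  moreover have "\<forall>\<^sub>F x in nhds z. f x * g x = poly (cpoly (u * u')) x / poly (cpoly (v * v')) x"
    using *(3,6) by eventually_elim (simp add: of_int_poly_mult)
  ultimately show ?thesis unfolding represents_near_def by blast
qed

lemma represents_near_inverse:
  assumes "represents_near z A f" "f z \<noteq> 0"
  shows "represents_near z (inverse A) (\<lambda>x. inverse (f x))"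
proof -
  obtain u v where *: "A = Fract u v" "poly (cpoly v) z \<noteq> 0"
     "\<forall>\<^sub>F x in nhds z. f x = poly (cpoly u) x / poly (cpoly v) x"
    using assms unfolding represents_near_def by blast
  have "inverse A = Fract v u" using * by simp
  moreover have "poly (cpoly u) z \<noteq> 0"
    using eventually_nhds_x_imp_x[OF *(3)] assms(2) by auto
  moreover have "\<forall>\<^sub>F x in nhds z. inverse (f x) = poly (cpoly v) x / poly (cpoly u) x"
    using *(3) by eventually_elim simp
  ultimately show ?thesis unfolding represents_near_def by blast
qed

lemma represents_near_of_nat: "represents_near z (of_nat k) (\<lambda>_. of_nat k)"
proof (induction k)
  case 0
  show ?case unfolding represents_near_def
    by (intro exI[of _ 0] exI[of _ 1]) (simp add: map_poly_1 Zero_fract_def)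
next
  case (Suc k)
  have "represents_near z 1 (\<lambda>_. 1)" unfolding represents_near_def
    by (intro exI[of _ 1]) (simp add: map_poly_1 One_fract_def)
  from represents_near_add[OF this Suc.IH] show ?case by simp
qed

lemma represents_near_numeral: "represents_near z (numeral k) (\<lambda>_. numeral k)"
  using represents_near_of_nat[of z "numeral k"] by simp

lemma represents_near_1: "represents_near z 1 (\<lambda>_. 1)"
  using represents_near_of_nat[of z 1] by simp

lemma represents_near_0: "represents_near z 0 (\<lambda>_. 0)"
  using represents_near_of_nat[of z 0] by simp

lemma represents_near_minus:
  assumes "represents_near z A f"
  shows "represents_near z (- A) (\<lambda>x. - f x)"
proof -
  obtain u v where *: "A = Fract u v" "poly (cpoly v) z \<noteq> 0"
     "\<forall>\<^sub>F x in nhds z. f x = poly (cpoly u) x / poly (cpoly v) x"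
    using assms unfolding represents_near_def by blast
  have "cpoly (- u) = - cpoly u" by (rule poly_eqI) (simp add: coeff_map_poly)
  hence "\<forall>\<^sub>F x in nhds z. - f x = poly (cpoly (- u)) x / poly (cpoly v) x"
    using *(3) by simp
  thus ?thesis
    unfolding represents_near_def using *(1,2) by (intro exI[of _ "- u"] exI[of _ v]) simp
qed

lemma represents_near_diff:
  assumes "represents_near z A f" "represents_near z B g"
  shows "represents_near z (A - B) (\<lambda>x. f x - g x)"
  using represents_near_add[OF assms(1) represents_near_minus[OF assms(2)]] by simp

lemma represents_near_divide:
  assumes "represents_near z A f" "represents_near z B g" "g z \<noteq> 0"
  shows "represents_near z (A / B) (\<lambda>x. f x / g x)"
  using represents_near_mult[OF assms(1) represents_near_inverse[OF assms(2,3)]]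
  by (simp add: divide_inverse)

lemma represents_near_power:
  "represents_near z A f \<Longrightarrow> represents_near z (A ^ k) (\<lambda>x. f x ^ k)"
  by (induction k) (auto intro: represents_near_1 represents_near_mult)

lemma represents_near_sum:
  "(\<And>i. i \<in> I \<Longrightarrow> represents_near z (A i) (f i)) \<Longrightarrow>
     represents_near z (\<Sum>i\<in>I. A i) (\<lambda>x. \<Sum>i\<in>I. f i x)"
  by (induction I rule: infinite_finite_induct)
    (auto intro: represents_near_0 represents_near_add)

lemma represents_near_prod:
  "(\<And>i. i \<in> I \<Longrightarrow> represents_near z (A i) (f i)) \<Longrightarrow>
     represents_near z (\<Prod>i\<in>I. A i) (\<lambda>x. \<Prod>i\<in>I. f i x)"
  by (induction I rule: infinite_finite_induct)
    (auto intro: represents_near_1 represents_near_mult)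

lemma represents_near_q_pochhammer:
  "represents_near z A f \<Longrightarrow> represents_near z B g \<Longrightarrow>
     represents_near z (q_pochhammer A B k) (\<lambda>x. q_pochhammer (f x) (g x) k)"
  unfolding q_pochhammer_def
  by (intro represents_near_prod represents_near_diff represents_near_1 represents_near_mult
      represents_near_power)

text \<open>The reduced denominator divides every denominator of \<open>A\<close>, in particular one
  that does not vanish at \<open>z\<close>.\<close>

lemma represents_near_denominator:
  assumes "represents_near z A f"
  shows "poly (cpoly (snd (quot_of_fract A))) z \<noteq> 0"
proof -
  obtain u v where *: "A = Fract u v" "poly (cpoly v) z \<noteq> 0"
    using assms unfolding represents_near_def by blast
  define N M where "N = fst (quot_of_fract A)" and "M = snd (quot_of_fract A)"
  have M0: "M \<noteq> 0" and cop: "coprime N M" and A: "Fract N M = A"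
    unfolding N_def M_def by (simp_all add: coprime_quot_of_fract Fract_quot_of_fract)
  have "v \<noteq> 0" using * by auto
  hence "N * v = u * M" using A *(1) M0 by (simp add: eq_fract)
  hence "M dvd N * v" by simp
  hence "M dvd v" using cop by (simp add: coprime_dvd_mult_right_iff coprime_commute)
  then obtain w where "v = M * w" ..
  thus ?thesis using *(2) by (simp add: M_def of_int_poly_mult)
qed

text \<open>If the order of \<open>z\<close> were at most k, multiplying the quotient by the missing
  power of x - z would give the cofactor, whose limit at \<open>z\<close> is nonzero.\<close>

lemma poly_little_o_imp_dvd:
  fixes p :: "complex poly"
  assumes "((\<lambda>x. poly p x / (x - z) ^ k) \<longlongrightarrow> 0) (at z)"
  shows "[:- z, 1:] ^ Suc k dvd p"
proof (rule ccontr)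
  assume "\<not> [:- z, 1:] ^ Suc k dvd p"
  hence p0: "p \<noteq> 0" and ord: "order z p \<le> k"
    using order_divides[of z "Suc k" p] by (auto simp: not_le)
  obtain r where r: "p = [:- z, 1:] ^ order z p * r" "\<not> [:- z, 1:] dvd r"
    using order_decomp[OF p0] by blast
  have rz: "poly r z \<noteq> 0" using r(2) by (simp add: poly_eq_0_iff_dvd)
  have "((\<lambda>x. poly p x / (x - z) ^ k * (x - z) ^ (k - order z p)) \<longlongrightarrow> 0 * (z - z) ^ (k - order z p)) (at z)"
    by (intro tendsto_intros assms)
  hence "((\<lambda>x. poly p x / (x - z) ^ k * (x - z) ^ (k - order z p)) \<longlongrightarrow> 0) (at z)" by simp
  moreover have "\<forall>\<^sub>F x in at z. poly p x / (x - z) ^ k * (x - z) ^ (k - order z p) = poly r x"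
    unfolding eventually_at_filter
  proof (intro always_eventually allI impI)
    fix x assume x: "x \<noteq> z"
    have "(x - z) ^ k = (x - z) ^ order z p * (x - z) ^ (k - order z p)"
      using ord by (simp add: power_add[symmetric])
    moreover have "poly p x = (x - z) ^ order z p * poly r x"
      by (subst r(1)) simp
    ultimately show "poly p x / (x - z) ^ k * (x - z) ^ (k - order z p) = poly r x"
      using x by simp
  qed
  ultimately have "(poly r \<longlongrightarrow> 0) (at z)" by (rule Lim_transform_eventually)
  moreover have "isCont (poly r) z" by simp
  hence "(poly r \<longlongrightarrow> poly r z) (at z)" by (simp only: isCont_def)
  ultimately show False using rz tendsto_unique[OF at_neq_bot] by blast
qed

text \<open>Near \<open>z\<close> the reduced numerator is \<open>f\<close> times the reduced
  denominator, which is continuous; the decay of \<open>f\<close> passes to the numerator.\<close>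

lemma represents_near_numerator_dvd:
  assumes A: "represents_near z A f" and lim: "((\<lambda>x. f x / (x - z) ^ k) \<longlongrightarrow> 0) (at z)"
  shows "[:- z, 1:] ^ Suc k dvd cpoly (fst (quot_of_fract A))"
proof (rule poly_little_o_imp_dvd)
  obtain u v where *: "A = Fract u v" "poly (cpoly v) z \<noteq> 0"
     "\<forall>\<^sub>F x in nhds z. f x = poly (cpoly u) x / poly (cpoly v) x"
    using A unfolding represents_near_def by blast
  define N M where "N = fst (quot_of_fract A)" and "M = snd (quot_of_fract A)"
  have M0: "M \<noteq> 0" and A': "Fract N M = A"
    unfolding N_def M_def by (simp_all add: Fract_quot_of_fract)
  have "v \<noteq> 0" using * by auto
  hence "N * v = u * M" using A' *(1) M0 by (simp add: eq_fract)
  hence eq: "cpoly N * cpoly v = cpoly u * cpoly M" by (metis of_int_poly_mult)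
  have "\<forall>\<^sub>F x in nhds z. poly (cpoly N) x = f x * poly (cpoly M) x"
    using *(3) eventually_poly_nonzero[OF *(2)]
  proof eventually_elim
    case (elim x)
    have "poly (cpoly N) x * poly (cpoly v) x = poly (cpoly u) x * poly (cpoly M) x"
      by (metis eq poly_mult)
    also have "poly (cpoly u) x = f x * poly (cpoly v) x" using elim by simp
    finally have "poly (cpoly N) x * poly (cpoly v) x = f x * poly (cpoly M) x * poly (cpoly v) x"
      by (simp only: mult_ac)
    thus ?case using elim(2) by simp
  qed
  hence "\<forall>\<^sub>F x in at z. f x / (x - z) ^ k * poly (cpoly M) x = poly (cpoly N) x / (x - z) ^ k"
    unfolding eventually_at_filter by eventually_elim simp
  moreover have "((\<lambda>x. f x / (x - z) ^ k * poly (cpoly M) x) \<longlongrightarrow> 0 * poly (cpoly M) z) (at z)"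
    by (intro tendsto_intros lim)
  hence "((\<lambda>x. f x / (x - z) ^ k * poly (cpoly M) x) \<longlongrightarrow> 0) (at z)" by simp
  ultimately have "((\<lambda>x. poly (cpoly N) x / (x - z) ^ k) \<longlongrightarrow> 0) (at z)"
    by (rule Lim_transform_eventually[rotated])
  thus "((\<lambda>x. poly (cpoly (fst (quot_of_fract A))) x / (x - z) ^ k) \<longlongrightarrow> 0) (at z)"
    by (simp only: N_def)
qed

section \<open>Coprimality and divisibility for powers of the cyclotomic polynomial\<close>

lemma cpoly_power: "cpoly (p ^ k) = cpoly p ^ k"
  by (induction k) (simp_all add: of_int_poly_mult map_poly_1)

lemma lead_coeff_cyclotomic: "lead_coeff (cyclotomic n) = 1"
proof -
  have "lead_coeff (cpoly (cyclotomic n)) = 1"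
    unfolding cyclotomic_poly by (simp add: lead_coeff_prod)
  moreover have "degree (cpoly (cyclotomic n)) = degree (cyclotomic n)"
    by (rule degree_map_poly) auto
  ultimately show ?thesis by (simp add: coeff_map_poly)
qed

text \<open>Pseudo-division by a monic polynomial is ordinary division over the integers. The
  complex image of the remainder is divisible by that of \<open>p\<close> but of smaller degree,
  hence 0.\<close>

lemma monic_dvd_of_cpoly_dvd:
  fixes p q :: "int poly"
  assumes "lead_coeff p = 1" "cpoly p dvd cpoly q"
  shows "p dvd q"
proof -
  have deg: "degree (cpoly r) = degree r" for r
    by (rule degree_map_poly) auto
  have p0: "p \<noteq> 0" using assms(1) by auto
  obtain s r where sr: "pseudo_divmod q p = (s, r)" by fastforce
  have f: "q = p * s + r" and r: "r = 0 \<or> degree r < degree p"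
    using pseudo_divmod[OF p0 sr] assms(1) by auto
  have "cpoly q = cpoly p * cpoly s + cpoly r"
    by (metis f of_int_poly_add of_int_poly_mult)
  hence "cpoly p dvd cpoly r" using assms(2) by (metis dvd_add_right_iff dvd_triv_left)
  hence "r = 0"
    using r dvd_imp_degree_le[of "cpoly p" "cpoly r"] deg of_int_poly_eq_iff[of r 0, where 'a = complex]
    by auto
  thus ?thesis using f by simp
qed

text \<open>A common divisor has a unit as leading coefficient because it divides a monic
  polynomial, so it is a unit once it is constant. Otherwise it has a complex root, necessarily a
  primitive n-th root of unity, at which \<open>p\<close> would vanish.\<close>

lemma coprime_cyclotomic_power:
  assumes "n > 0" "\<And>z. z \<in> primitive_roots_unity n \<Longrightarrow> poly (cpoly p) z \<noteq> 0"
  shows "coprime p (cyclotomic n ^ k)"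
proof (rule coprimeI)
  fix d assume d: "d dvd p" "d dvd cyclotomic n ^ k"
  have "lead_coeff d dvd lead_coeff (cyclotomic n ^ k)"
    using d(2) by (auto elim!: dvdE simp: lead_coeff_mult)
  hence lc: "is_unit (lead_coeff d)" by (simp add: lead_coeff_power lead_coeff_cyclotomic)
  have deg: "degree (cpoly d) = degree d" by (rule degree_map_poly) auto
  have "degree d = 0"
  proof (rule ccontr)
    assume "degree d \<noteq> 0"
    hence "\<not> constant (poly (cpoly d))" by (simp add: constant_degree deg)
    then obtain w where w: "poly (cpoly d) w = 0" using fundamental_theorem_of_algebra by blast
    obtain e e' where e: "p = d * e" "cyclotomic n ^ k = d * e'" using d by (auto elim!: dvdE)
    have "cpoly (cyclotomic n) ^ k = cpoly d * cpoly e'"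
      by (metis e(2) cpoly_power of_int_poly_mult)
    hence "poly (cpoly (cyclotomic n)) w = 0"
      using w by (metis mult_zero_left poly_mult poly_power power_eq_0_iff)
    hence "w \<in> primitive_roots_unity n"
      unfolding cyclotomic_poly using finite_primitive_roots_unity[OF assms(1)]
      by (auto simp: poly_prod)
    hence "poly (cpoly p) w \<noteq> 0" by (rule assms(2))
    thus False using w e(1) by (simp add: of_int_poly_mult)
  qed
  then obtain a where "d = [:a:]" by (auto elim: degree_eq_zeroE)
  thus "is_unit d" using lc by (simp add: is_unit_const_poly_iff)
qed

lemma prod_linear_power_dvd:
  fixes p :: "'a::field poly"
  assumes "finite S" "\<And>z. z \<in> S \<Longrightarrow> [:- z, 1:] ^ k dvd p"
  shows "(\<Prod>z\<in>S. [:- z, 1:] ^ k) dvd p"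
proof (cases "p = 0")
  case False
  show ?thesis using assms
  proof (induction S rule: finite_induct)
    case (insert z S)
    define g where "g = (\<Prod>z\<in>S. [:- z, 1:] ^ k)"
    obtain r where r: "p = g * r" using insert unfolding g_def by (auto elim!: dvdE)
    have "poly g z \<noteq> 0" using insert.hyps by (auto simp: g_def poly_prod)
    hence "order z g = 0" by (rule order_0I)
    hence "order z p = order z r" using False r by (simp add: order_mult)
    moreover have "k \<le> order z p" using insert.prems[of z] False by (simp add: order_divides)
    ultimately have "[:- z, 1:] ^ k dvd r" by (simp add: order_divides)
    hence "[:- z, 1:] ^ k * g dvd r * g" by (rule mult_dvd_mono) simp
    moreover have "(\<Prod>z\<in>insert z S. [:- z, 1:] ^ k) = [:- z, 1:] ^ k * g"
      using insert.hyps unfolding g_def by (rule prod.insert)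
    ultimately show ?case using r by (metis mult.commute)
  qed simp
qed simp

lemma cyclotomic_power_dvd:
  assumes "n > 0" "\<And>z. z \<in> primitive_roots_unity n \<Longrightarrow> [:- z, 1:] ^ k dvd cpoly p"
  shows "cyclotomic n ^ k dvd p"
proof (rule monic_dvd_of_cpoly_dvd)
  show "lead_coeff (cyclotomic n ^ k) = 1" by (simp add: lead_coeff_power lead_coeff_cyclotomic)
  have "(\<Prod>z\<in>primitive_roots_unity n. [:- z, 1:] ^ k) dvd cpoly p"
    by (rule prod_linear_power_dvd) (use assms finite_primitive_roots_unity in auto)
  thus "cpoly (cyclotomic n ^ k) dvd cpoly p"
    unfolding cpoly_power cyclotomic_poly prod_power_distrib .
qed

section \<open>The congruence\<close>

lemmas represents_near_intros =
  represents_near_var represents_near_1 represents_near_numeral represents_near_add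
  represents_near_diff represents_near_mult represents_near_inverse represents_near_divide
  represents_near_power represents_near_sum represents_near_prod represents_near_q_pochhammer

theorem theorem1p2:
  fixes n :: nat and q :: "int poly fract"
  defines "q \<equiv> ratfun_var"
  assumes "n > 0" and "[n = 5] (mod 6)"
  shows "ratfun_cong
    (\<Sum>k = 0..(n + 1) div 3.
       q_pochhammer (inverse q) (q ^ 3) k ^ 3 / q_pochhammer (q ^ 3) (q ^ 3) k ^ 3 * q ^ (9 * k))
    (q powi ((2 - int n) div 3) * (1 + q)
       * (q_pochhammer q (q ^ 3) ((n + 1) div 3) ^ 2
            / q_pochhammer (q ^ 3) (q ^ 3) ((n + 1) div 3) ^ 2)
       * (theta n q + q_int q n ^ 2 *
            ((\<Sum>i = 1..(n + 1) div 3. 3 * q ^ (3 * i - 2) / q_int q (3 * i - 2) ^ 2)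
               - (1 + 5 * q + 3 * q ^ 2) / (1 + q))))
    (cyclotomic n ^ 3)"
proof -
  have "n mod 6 = 5" using assms(3) by (simp add: cong_def)
  hence "n = 3 * (2 * (n div 6)) + 5" using div_mult_mod_eq[of n 6] by linarith
  then obtain m where n: "n = 3 * m + 5" by blast
  have N: "(n + 1) div 3 = m + 2" unfolding n by simp
  \<comment> \<open>The division is exact, so the power of q in the statement is the one in
    \<open>prefactor\<close>.\<close>
  have "(2 - int n) div 3 = - int (m + 1)" unfolding n by simp
  hence powi: "q powi ((2 - int n) div 3) = inverse q ^ (m + 1)"
    by (simp only: power_int_minus power_int_of_nat power_inverse)
  \<comment> \<open>The formulas make sense in any field; read over the complex numbers they
    represent the two rational functions near each primitive root.\<close>
  define L where "L x = deformed_sum (m + 2) 2 x" for x :: complex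
  define R where "R x = prefactor m x * (theta n x + q_int x n ^ 2 * correction m x)" for x :: complex
  have L: "represents_near z (deformed_sum (m + 2) 2 q) L"
    and R: "represents_near z (prefactor m q * (theta n q + q_int q n ^ 2 * correction m q)) R"
    and lim: "((\<lambda>x. (L x - R x) / (x - z) ^ 2) \<longlongrightarrow> 0) (at z)"
    if z: "z \<in> primitive_roots_unity n" for z
  proof -
    have zn: "z ^ n = 1" and good: "\<And>j. 0 < j \<Longrightarrow> j < n \<Longrightarrow> z ^ j \<noteq> 1"
      using z by (auto simp: primitive_roots_unity_def)
    have z0: "z \<noteq> 0" using zn n by (auto simp: power_0_left)
    have z1: "1 - z \<noteq> 0" using good[of 1] n by simp
    have z2: "1 + z \<noteq> 0" using good[of 2] n by (intro one_plus_nonzero) simp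
    have P: "q_pochhammer (z ^ 3) (z ^ 3) k \<noteq> 0" if "k \<le> m + 2" for k
      using that n
      by (intro q_pochhammer_cube_nonzero[OF n] primitive_root_power_neq_one[OF zn good]) simp_all
    have Z: "q_int z (3 * i - 2) \<noteq> 0" if "i \<in> {1..m + 2}" for i
    proof -
      have "0 < 3 * i - 2" "3 * i - 2 < n" using that unfolding n by auto
      thus ?thesis using good[of "3 * i - 2"] z1 by (simp add: q_int_def)
    qed
    have q_int: "represents_near z (q_int q j) (\<lambda>x. q_int x j)" for j
      unfolding q_int_def q_def by (intro represents_near_intros) (use z1 in auto)
    show "represents_near z (deformed_sum (m + 2) 2 q) L"
      unfolding deformed_sum_def L_def [abs_def] q_def
      by (intro represents_near_intros) (use P z0 in auto)
    have "represents_near z (prefactor m q) (prefactor m)"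
      unfolding prefactor_def [abs_def] q_def by (intro represents_near_intros) (use P z0 in auto)
    moreover have "represents_near z (theta n q) (theta n)"
      unfolding theta_def [abs_def] q_def by (intro represents_near_intros) (use zn z1 z2 in auto)
    moreover have "represents_near z (correction m q) (correction m)"
      unfolding correction_def [abs_def] using Z z2
      by (intro represents_near_intros q_int) (auto simp: q_def intro!: represents_near_intros)
    ultimately show "represents_near z (prefactor m q * (theta n q + q_int q n ^ 2 * correction m q)) R"
      unfolding R_def [abs_def] by (intro represents_near_intros q_int)
    show "((\<lambda>x. (L x - R x) / (x - z) ^ 2) \<longlongrightarrow> 0) (at z)"
      unfolding L_def R_def by (rule difference_limit[OF n zn good])
  qed
  have "ratfun_cong (deformed_sum (m + 2) 2 q)
      (prefactor m q * (theta n q + q_int q n ^ 2 * correction m q)) (cyclotomic n ^ 3)"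
    unfolding ratfun_cong_def
  proof (intro conjI)
    show "coprime (snd (quot_of_fract (deformed_sum (m + 2) 2 q))) (cyclotomic n ^ 3)"
      by (intro coprime_cyclotomic_power represents_near_denominator[OF L] assms(2))
    show "coprime (snd (quot_of_fract (prefactor m q * (theta n q + q_int q n ^ 2 * correction m q))))
        (cyclotomic n ^ 3)"
      by (intro coprime_cyclotomic_power represents_near_denominator[OF R] assms(2))
    show "cyclotomic n ^ 3 dvd fst (quot_of_fract (deformed_sum (m + 2) 2 q
        - prefactor m q * (theta n q + q_int q n ^ 2 * correction m q)))"
    proof (rule cyclotomic_power_dvd[OF assms(2)])
      fix z assume z: "z \<in> primitive_roots_unity n"
      show "[:- z, 1:] ^ 3 dvd cpoly (fst (quot_of_fract (deformed_sum (m + 2) 2 q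
        - prefactor m q * (theta n q + q_int q n ^ 2 * correction m q))))"
        \<comment> \<open>Being o((x - z)^2) yields the exponent \<open>Suc 2\<close>, that is, the
          cube.\<close>
        using represents_near_numerator_dvd[OF represents_near_diff[OF L[OF z] R[OF z]] lim[OF z]]
        by (simp only: numeral_3_eq_3 numeral_2_eq_2)
    qed
  qed
  thus ?thesis
    unfolding N powi deformed_sum_2 prefactor_def correction_def .
qed

end
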